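(* Let $\gamma>0$. The Fenchel dual problem corresponding to minimizing $$\mathcal F_\gamma(u)=\tfrac12\|u-f\|_{L^2(\Omega)}^2+\int_\Omega\varphi_\gamma(x,|\nabla u|)\,dx\quad\text{over }u\in X_\gamma$$ is $$\sup_{p\in K_\gamma}\Bigl\{-\tfrac12\|\operatorname{div}p\|_{L^2(\Omega)}^2-\int_\Omega f\,\operatorname{div}p\,dx-\int_\Omega\varphi_\gamma^*(x,|p(x)|)\,dx\Bigr\},$$ where $$K_\gamma:=\Bigl\{p\in L^{\varphi_\gamma^*}(\Omega;\mathbb R^N):\ \operatorname{div}p\in L^2(\Omega)\text{ and }\int_\Omega p\cdot\nabla u\,dx=-\int_\Omega(\operatorname{div}p)\,u\,dx\ \text{for all }u\in X_\gamma\Bigr\}$$ (that is, for $p\in L^{\varphi_\gamma^*}(\Omega;\mathbb R^N)$ the Fenchel dual objective equals the expression in braces if $p\in K_\gamma$ and equals $-\infty$ otherwise).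
   Context: $\Omega\subset\mathbb R^N$ is a bounded Lipschitz domain, $f\in L^2(\Omega)$, $\alpha>0$ is fixed, and $\kappa\in L^\infty(\Omega)$ is fixed with $0<\kappa_-\le\kappa(x)\le\kappa_+<\infty$ for a.e. $x\in\Omega$. With $\log^+r:=\max\{0,\log r\}$ for $r>0$ and $\log^+0:=0$, $$\varphi_\gamma(x,t):=\alpha t\Bigl(1+\gamma\log^+\frac{t}{\kappa(x)}\Bigr)\ (t\ge0),\qquad \varphi_\gamma^*(x,s):=\sup_{t\ge0}\{st-\varphi_\gamma(x,t)\}\ (s\ge0).$$ For $\psi\in\{\varphi_\gamma,\varphi_\gamma^*\}$, $L^\psi(\Omega;\mathbb R^N)$ is the space of measurable $v:\Omega\to\mathbb R^N$ with $\int_\Omega\psi(x,\lambda|v(x)|)\,dx<\infty$ for some $\lambda>0$, with Luxemburg norm $\|v\|_\psi:=\inf\{\lambda>0:\int_\Omega\psi(x,|v(x)|/\lambda)\,dx\le1\}$. $X_\gamma:=\{u\in L^2(\Omega)\cap W^{1,1}(\Omega):\int_\Omega\varphi_\gamma(x,|\nabla u|)\,dx<\infty\}$, a Banach space with norm $\|u\|_{L^2(\Omega)}+\|\nabla u\|_{\varphi_\gamma}$. Put $Y:=L^{\varphi_\gamma}(\Omega;\mathbb R^N)$, $A:X_\gamma\to Y$, $Au:=\nabla u$, $F(u):=\frac12\|u-f\|_{L^2(\Omega)}^2$ on $X_\gamma$, and $G(v):=\int_\Omega\varphi_\gamma(x,|v|)\,dx$ on $Y$, so that $\mathcal F_\gamma=F+G\circ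 A$. The Fenchel dual problem is $\sup_{p\in Y^*}(-F^*(-A^*p)-G^*(p))$ with Fenchel conjugates $F^*(x^* )=\sup_{u\in X_\gamma}(\langle x^*,u\rangle-F(u))$ on $X_\gamma^*$ and $G^*(p)=\sup_{v\in Y}(\langle p,v\rangle-G(v))$ on $Y^*$; $Y^*$ is identified with $L^{\varphi_\gamma^*}(\Omega;\mathbb R^N)$ through $\langle p,v\rangle=\int_\Omega p\cdot v\,dx$. The divergence is understood in the distributional sense, and the integration-by-parts identity in $K_\gamma$ is the weak homogeneous normal boundary condition. *)

theory Defs
  imports "HOL-Analysis.Analysis"
begin

text \<open>
  Elements of the function spaces below are functions on the whole space that only matter on
  \<open>\<Omega>\<close>, up to null sets.  Almost everywhere equal functions are not identified, so the norms are
  seminorms on the spaces of representatives; all suprema, duals and conjugates are unaffected.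
\<close>


subsection \<open>Domains\<close>

text \<open>
  Near each boundary point, \<open>\<Omega>\<close> is the strict epigraph, in some direction \<open>\<nu>\<close>, of a Lipschitz
  function on the hyperplane orthogonal to \<open>\<nu>\<close>.
\<close>
definition lipschitz_domain :: "'a::euclidean_space set \<Rightarrow> bool" where
  "lipschitz_domain \<Omega> \<longleftrightarrow> open \<Omega> \<and> connected \<Omega> \<and> \<Omega> \<noteq> {} \<and>
     (\<forall>z\<in>frontier \<Omega>. \<exists>r>0. \<exists>\<nu> g L. norm \<nu> = 1 \<and> lipschitz_on L {y. y \<bullet> \<nu> = 0} g \<and>
        \<Omega> \<inter> ball z r = {x \<in> ball z r. g (x - (x \<bullet> \<nu>) *\<^sub>R \<nu>) < x \<bullet> \<nu>})"


subsection \<open>Test functions, weak gradient, distributional divergence\<close>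

primrec continuously_diff :: "nat \<Rightarrow> ('a::euclidean_space \<Rightarrow> real) \<Rightarrow> bool" where
  "continuously_diff 0 \<phi> \<longleftrightarrow> continuous_on UNIV \<phi>"
| "continuously_diff (Suc k) \<phi> \<longleftrightarrow>
     (\<exists>g. (\<forall>x. GDERIV \<phi> x :> g x) \<and> (\<forall>b\<in>Basis. continuously_diff k (\<lambda>x. g x \<bullet> b)))"

definition test_functions :: "'a::euclidean_space set \<Rightarrow> ('a \<Rightarrow> real) set" where
  "test_functions \<Omega> =
     {\<phi>. (\<forall>k. continuously_diff k \<phi>) \<and> compact (closure {x. \<phi> x \<noteq> 0}) \<and> closure {x. \<phi> x \<noteq> 0} \<subseteq> \<Omega>}"

definition grad :: "('a::euclidean_space \<Rightarrow> real) \<Rightarrow> 'a \<Rightarrow> 'a" where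
  "grad \<phi> x = (THE D. GDERIV \<phi> x :> D)"

definition locally_integrable ::
    "'a::euclidean_space set \<Rightarrow> ('a \<Rightarrow> 'b::euclidean_space) \<Rightarrow> bool" where
  "locally_integrable \<Omega> v \<longleftrightarrow> (\<forall>C. compact C \<and> C \<subseteq> \<Omega> \<longrightarrow> v absolutely_integrable_on C)"

text \<open>Local integrability matters: the Bochner integral of a non-integrable function is 0.\<close>
definition has_weak_grad :: "'a::euclidean_space set \<Rightarrow> ('a \<Rightarrow> real) \<Rightarrow> ('a \<Rightarrow> 'a) \<Rightarrow> bool" where
  "has_weak_grad \<Omega> u g \<longleftrightarrow> locally_integrable \<Omega> u \<and> locally_integrable \<Omega> g \<and>
     (\<forall>\<phi>\<in>test_functions \<Omega>.
        (LINT x|lebesgue_on \<Omega>. u x *\<^sub>R grad \<phi> x) = - (LINT x|lebesgue_on \<Omega>. \<phi> x *\<^sub>R g x))"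

definition weak_grad :: "'a::euclidean_space set \<Rightarrow> ('a \<Rightarrow> real) \<Rightarrow> 'a \<Rightarrow> 'a" where
  "weak_grad \<Omega> u = (SOME g. has_weak_grad \<Omega> u g)"

definition has_distr_div :: "'a::euclidean_space set \<Rightarrow> ('a \<Rightarrow> 'a) \<Rightarrow> ('a \<Rightarrow> real) \<Rightarrow> bool" where
  "has_distr_div \<Omega> p d \<longleftrightarrow> locally_integrable \<Omega> p \<and> locally_integrable \<Omega> d \<and>
     (\<forall>\<phi>\<in>test_functions \<Omega>.
        (LINT x|lebesgue_on \<Omega>. p x \<bullet> grad \<phi> x) = - (LINT x|lebesgue_on \<Omega>. d x * \<phi> x))"

definition distr_div :: "'a::euclidean_space set \<Rightarrow> ('a \<Rightarrow> 'a) \<Rightarrow> 'a \<Rightarrow> real" where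
  "distr_div \<Omega> p = (SOME d. has_distr_div \<Omega> p d)"


subsection \<open>Function spaces\<close>

definition L2 :: "'a::euclidean_space set \<Rightarrow> ('a \<Rightarrow> real) set" where
  "L2 \<Omega> = {u \<in> borel_measurable (lebesgue_on \<Omega>). integrable (lebesgue_on \<Omega>) (\<lambda>x. (u x)\<^sup>2)}"

definition L2_norm :: "'a::euclidean_space set \<Rightarrow> ('a \<Rightarrow> real) \<Rightarrow> real" where
  "L2_norm \<Omega> u = sqrt (LINT x|lebesgue_on \<Omega>. (u x)\<^sup>2)"

definition W11 :: "'a::euclidean_space set \<Rightarrow> ('a \<Rightarrow> real) set" where
  "W11 \<Omega> = {u. integrable (lebesgue_on \<Omega>) u \<and>
                (\<exists>g. has_weak_grad \<Omega> u g \<and> integrable (lebesgue_on \<Omega>) g)}"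

text \<open>
  In the spaces of Musielak-Orlicz type the integrand \<open>\<psi>\<close> is extended real valued and nonnegative
  (almost everywhere) on nonnegative arguments, so \<open>e2ennreal\<close> loses nothing.
\<close>
definition modular ::
    "'a::euclidean_space set \<Rightarrow> ('a \<Rightarrow> real \<Rightarrow> ereal) \<Rightarrow> ('a \<Rightarrow> 'a) \<Rightarrow> ennreal" where
  "modular \<Omega> \<psi> v = (\<integral>\<^sup>+x. e2ennreal (\<psi> x (norm (v x))) \<partial>lebesgue_on \<Omega>)"

definition MO_space ::
    "'a::euclidean_space set \<Rightarrow> ('a \<Rightarrow> real \<Rightarrow> ereal) \<Rightarrow> ('a \<Rightarrow> 'a) set" where
  "MO_space \<Omega> \<psi> = {v \<in> borel_measurable (lebesgue_on \<Omega>).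
                      \<exists>l>0. modular \<Omega> \<psi> (\<lambda>x. l *\<^sub>R v x) < \<infinity>}"

definition luxemburg_norm ::
    "'a::euclidean_space set \<Rightarrow> ('a \<Rightarrow> real \<Rightarrow> ereal) \<Rightarrow> ('a \<Rightarrow> 'a) \<Rightarrow> real" where
  "luxemburg_norm \<Omega> \<psi> v = Inf {l. l > 0 \<and> modular \<Omega> \<psi> (\<lambda>x. v x /\<^sub>R l) \<le> 1}"

definition log_plus :: "real \<Rightarrow> real" where
  "log_plus r = (if r > 0 then max 0 (ln r) else 0)"

definition phi :: "real \<Rightarrow> real \<Rightarrow> ('a \<Rightarrow> real) \<Rightarrow> 'a \<Rightarrow> real \<Rightarrow> ereal" where
  "phi \<alpha> \<gamma> \<kappa> x t = ereal (\<alpha> * t * (1 + \<gamma> * log_plus (t / \<kappa> x)))"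

definition phi_star :: "real \<Rightarrow> real \<Rightarrow> ('a \<Rightarrow> real) \<Rightarrow> 'a \<Rightarrow> real \<Rightarrow> ereal" where
  "phi_star \<alpha> \<gamma> \<kappa> x s = (SUP t\<in>{0..}. ereal (s * t) - phi \<alpha> \<gamma> \<kappa> x t)"

definition X_space ::
    "'a::euclidean_space set \<Rightarrow> real \<Rightarrow> real \<Rightarrow> ('a \<Rightarrow> real) \<Rightarrow> ('a \<Rightarrow> real) set" where
  "X_space \<Omega> \<alpha> \<gamma> \<kappa> = {u \<in> L2 \<Omega> \<inter> W11 \<Omega>. modular \<Omega> (phi \<alpha> \<gamma> \<kappa>) (weak_grad \<Omega> u) < \<infinity>}"

abbreviation Y_space ::
    "'a::euclidean_space set \<Rightarrow> real \<Rightarrow> real \<Rightarrow> ('a \<Rightarrow> real) \<Rightarrow> ('a \<Rightarrow> 'a) set" where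
  "Y_space \<Omega> \<alpha> \<gamma> \<kappa> \<equiv> MO_space \<Omega> (phi \<alpha> \<gamma> \<kappa>)"


subsection \<open>Duality\<close>

text \<open>
  Continuous linear functionals on a space \<open>V\<close> of functions with (semi)norm \<open>nrm\<close>; their values
  outside \<open>V\<close> are irrelevant.
\<close>
definition dual_space ::
    "('a \<Rightarrow> 'b::real_vector) set \<Rightarrow> (('a \<Rightarrow> 'b) \<Rightarrow> real) \<Rightarrow> (('a \<Rightarrow> 'b) \<Rightarrow> real) set" where
  "dual_space V nrm = {l.
     (\<forall>v\<in>V. \<forall>w\<in>V. l (\<lambda>x. v x + w x) = l v + l w) \<and>
     (\<forall>c. \<forall>v\<in>V. l (\<lambda>x. c *\<^sub>R v x) = c * l v) \<and>
     (\<exists>C. \<forall>v\<in>V. \<bar>l v\<bar> \<le> C * nrm v)}"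

definition fenchel_conj :: "'v set \<Rightarrow> ('v \<Rightarrow> ereal) \<Rightarrow> ('v \<Rightarrow> real) \<Rightarrow> ereal" where
  "fenchel_conj V E l = (SUP v\<in>V. ereal (l v) - E v)"

text \<open>
  For the primal problem of minimizing \<open>F u + G (A u)\<close> over \<open>u \<in> X\<close>, with \<open>A\<close> mapping \<open>X\<close> to \<open>Y\<close>,
  the objective \<open>- F\<^sup>* (- A\<^sup>* l) - G\<^sup>* l\<close>, where \<open>A\<^sup>* l = l \<circ> A\<close>.
\<close>
definition fenchel_dual_objective ::
    "'u set \<Rightarrow> 'v set \<Rightarrow> ('u \<Rightarrow> 'v) \<Rightarrow> ('u \<Rightarrow> ereal) \<Rightarrow> ('v \<Rightarrow> ereal) \<Rightarrow> ('v \<Rightarrow> real) \<Rightarrow> ereal" where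
  "fenchel_dual_objective X Y A F G l =
     - fenchel_conj X F (\<lambda>u. - (l \<circ> A) u) - fenchel_conj Y G l"

definition pairing :: "'a::euclidean_space set \<Rightarrow> ('a \<Rightarrow> 'a) \<Rightarrow> ('a \<Rightarrow> 'a) \<Rightarrow> real" where
  "pairing \<Omega> p v = (LINT x|lebesgue_on \<Omega>. p x \<bullet> v x)"


subsection \<open>The primal and dual problems\<close>

definition energy ::
    "'a::euclidean_space set \<Rightarrow> real \<Rightarrow> real \<Rightarrow> ('a \<Rightarrow> real) \<Rightarrow> ('a \<Rightarrow> real) \<Rightarrow> ('a \<Rightarrow> real) \<Rightarrow> ereal" where
  "energy \<Omega> \<alpha> \<gamma> \<kappa> f u =
     ereal (1/2 * (L2_norm \<Omega> (\<lambda>x. u x - f x))\<^sup>2) + enn2ereal (modular \<Omega> (phi \<alpha> \<gamma> \<kappa>) (weak_grad \<Omega> u))"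

definition F_fun :: "'a::euclidean_space set \<Rightarrow> ('a \<Rightarrow> real) \<Rightarrow> ('a \<Rightarrow> real) \<Rightarrow> ereal" where
  "F_fun \<Omega> f u = ereal (1/2 * (L2_norm \<Omega> (\<lambda>x. u x - f x))\<^sup>2)"

definition G_fun ::
    "'a::euclidean_space set \<Rightarrow> real \<Rightarrow> real \<Rightarrow> ('a \<Rightarrow> real) \<Rightarrow> ('a \<Rightarrow> 'a) \<Rightarrow> ereal" where
  "G_fun \<Omega> \<alpha> \<gamma> \<kappa> v = enn2ereal (modular \<Omega> (phi \<alpha> \<gamma> \<kappa>) v)"

definition K_set ::
    "'a::euclidean_space set \<Rightarrow> real \<Rightarrow> real \<Rightarrow> ('a \<Rightarrow> real) \<Rightarrow> ('a \<Rightarrow> 'a) set" where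
  "K_set \<Omega> \<alpha> \<gamma> \<kappa> = {p \<in> MO_space \<Omega> (phi_star \<alpha> \<gamma> \<kappa>).
     (\<exists>d\<in>L2 \<Omega>. has_distr_div \<Omega> p d) \<and>
     (\<forall>u\<in>X_space \<Omega> \<alpha> \<gamma> \<kappa>.
        (LINT x|lebesgue_on \<Omega>. p x \<bullet> weak_grad \<Omega> u x) = - (LINT x|lebesgue_on \<Omega>. distr_div \<Omega> p x * u x))}"

text \<open>
  The last term may be \<open>\<infinity>\<close>: the conjugate integrand grows exponentially, so membership in the
  Musielak-Orlicz space does not make the modular finite.
\<close>
definition dual_expr ::
    "'a::euclidean_space set \<Rightarrow> real \<Rightarrow> real \<Rightarrow> ('a \<Rightarrow> real) \<Rightarrow> ('a \<Rightarrow> real) \<Rightarrow> ('a \<Rightarrow> 'a) \<Rightarrow> ereal" where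
  "dual_expr \<Omega> \<alpha> \<gamma> \<kappa> f p =
     ereal (- (1/2) * (L2_norm \<Omega> (distr_div \<Omega> p))\<^sup>2 - (LINT x|lebesgue_on \<Omega>. f x * distr_div \<Omega> p x))
       - enn2ereal (modular \<Omega> (phi_star \<alpha> \<gamma> \<kappa>) p)"

end

theory Submission
  imports Defs
begin

text \<open>
  Since \<open>X\<close> is dense in \<open>L\<^sup>2\<close>, completing the square in \<open>F\<^sup>*(-A\<^sup>*p)\<close> gives the first two terms of the
  dual objective when \<open>p \<in> K\<^sub>\<gamma>\<close>.  Conversely, finiteness of \<open>F\<^sup>*(-A\<^sup>*p)\<close> bounds \<open>u \<mapsto> \<integral> p \<cdot> \<nabla>u\<close> by
  \<open>c + \<parallel>u\<parallel>\<^sup>2\<close>, so the Riesz theorem represents it by an \<open>L\<^sup>2\<close> function, which is \<open>-div p\<close>, and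
  \<open>p \<in> K\<^sub>\<gamma>\<close>.  The conjugate of \<open>G\<close> is computed pointwise, by truncating the measurable selection of
  maximizers in Young's inequality.  Finally, every functional on \<open>Y\<close> is integration against some
  \<open>p \<in> L\<^bsup>\<phi>*\<^esup>\<close>, so that the supremum over \<open>Y\<^sup>*\<close> is the supremum over such \<open>p\<close>.
\<close>

subsection \<open>Smooth bump functions\<close>

text \<open>\<open>weak_grad\<close> and \<open>distr_div\<close> are chosen by \<open>SOME\<close>,
  so each use of them needs uniqueness up to null sets; this calls for the fundamental lemma, and
  that for smooth functions approximating indicators of boxes. Functions are not identified almost
  everywhere, so the Riesz theorem is proved on representatives, by minimizing a quadratic
  functional. Its hypothesis is a one-sided bound A + B |v|^2 in place of continuity: this is the
  form in which finiteness of a conjugate, or quadratic growth of \<open>phi\<close>, is available.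
  The two integrands behave differently. \<open>phi\<close> is doubling, at most quadratic and at
  least linear, so every element of Y has finite modular and L^2 lies in Y, which lies in L^1.
  \<open>phi_star\<close> grows exponentially, so a field of the conjugate space may have infinite
  modular, and the maximizer in Young's inequality may fall outside Y. Hence the truncation to {|p|
  <= n} and the computation of modulars in \<open>ennreal\<close>.\<close>

definition flat :: "nat \<Rightarrow> real \<Rightarrow> real" where
  "flat k t = (if t > 0 then exp (- 1 / t) / t ^ k else 0)"

text \<open>With x = 1/h the difference quotient from the right is x^(k+1) / exp x, which tends to 0
  as x grows.\<close>

lemma flat_zero_deriv: "(flat k has_real_derivative 0) (at 0)"
proof -
  have lim: "((\<lambda>x. x ^ Suc k / exp x) \<longlongrightarrow> (0::real)) at_top"
    by (rule tendsto_power_div_exp_0)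
  have "((\<lambda>h. (inverse h) ^ Suc k / exp (inverse h)) \<longlongrightarrow> (0::real)) (at_right 0)"
    by (rule filterlim_compose[OF lim filterlim_inverse_at_top_right])
  then have right: "((\<lambda>h. (flat k (0 + h) - flat k 0) / h) \<longlongrightarrow> 0) (at_right 0)"
    by (rule Lim_transform_eventually)
       (auto simp: flat_def eventually_at_right_field exp_minus field_simps intro!: exI[of _ 1])
  have left: "((\<lambda>h. (flat k (0 + h) - flat k 0) / h) \<longlongrightarrow> 0) (at_left 0)"
    by (rule Lim_transform_eventually[OF tendsto_const])
       (auto simp: flat_def eventually_at_left_field intro!: exI[of _ "-1"])
  show ?thesis
    unfolding DERIV_def using right left by (rule filterlim_split_at_real[rotated])
qed

text \<open>The index k exists for this identity: differentiation only shifts it, so the family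
  spans a class closed under derivatives.\<close>

lemma flat_has_derivative:
  "(flat k has_real_derivative flat (k + 2) t - real k * flat (k + 1) t) (at t)"
proof -
  consider "t < 0" | "t = 0" | "t > 0" by linarith
  then show ?thesis
  proof cases
    case 1
    have "((\<lambda>_. 0) has_real_derivative 0) (at t)" by simp
    then have "(flat k has_real_derivative 0) (at t)"
      by (rule DERIV_cong_ev[THEN iffD1, rotated 3])
         (use 1 in \<open>auto simp: flat_def eventually_nhds intro!: exI[of _ "{..<0}"]\<close>)
    with 1 show ?thesis by (simp add: flat_def)
  next
    case 2
    then show ?thesis using flat_zero_deriv[of k] by (simp add: flat_def)
  next
    case 3
    have "((\<lambda>t. exp (- 1 / t) / t ^ k) has_real_derivative
        exp (- 1 / t) / t ^ (k + 2) - real k * (exp (- 1 / t) / t ^ (k + 1))) (at t)"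
      using 3 by (auto intro!: derivative_eq_intros)
         (cases k; simp add: field_simps power2_eq_square)
    then have "(flat k has_real_derivative exp (- 1 / t) / t ^ (k + 2) - real k * (exp (- 1 / t) / t ^ (k + 1))) (at t)"
      by (rule DERIV_cong_ev[THEN iffD1, rotated 3])
         (use 3 in \<open>auto simp: flat_def eventually_nhds intro!: exI[of _ "{0<..}"]\<close>)
    with 3 show ?thesis by (simp add: flat_def)
  qed
qed

text \<open>A class of functions on the line that contains the bumps and is closed under differentiation,
  so that all its members, and all products of them in separate coordinates, are smooth.\<close>
inductive_set smooth1 :: "(real \<Rightarrow> real) set" where
  flat: "(\<lambda>t. c * flat k (a * t + b)) \<in> smooth1"
| add: "f \<in> smooth1 \<Longrightarrow> g \<in> smooth1 \<Longrightarrow> (\<lambda>t. f t + g t) \<in> smooth1"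
| mult: "f \<in> smooth1 \<Longrightarrow> g \<in> smooth1 \<Longrightarrow> (\<lambda>t. f t * g t) \<in> smooth1"

lemma smooth1_deriv:
  "f \<in> smooth1 \<Longrightarrow> \<exists>f'\<in>smooth1. \<forall>t. (f has_real_derivative f' t) (at t)"
proof (induction rule: smooth1.induct)
  case (flat c k a b)
  let ?g = "\<lambda>t. (c * a) * flat (k + 2) (a * t + b) + (- c * a * real k) * flat (k + 1) (a * t + b)"
  have "?g \<in> smooth1" by (intro smooth1.intros)
  moreover have "((\<lambda>t. c * flat k (a * t + b)) has_real_derivative ?g t) (at t)" for t
    by (auto intro!: derivative_eq_intros DERIV_chain2[OF flat_has_derivative] simp: algebra_simps)
  ultimately show ?case by (intro bexI[of _ ?g]) auto
next
  case (add f g)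
  from add.IH(1) obtain f' where "f' \<in> smooth1" "\<forall>t. (f has_real_derivative f' t) (at t)" ..
  moreover from add.IH(2) obtain g' where "g' \<in> smooth1" "\<forall>t. (g has_real_derivative g' t) (at t)" ..
  ultimately show ?case
    by (intro bexI[of _ "\<lambda>t. f' t + g' t"]) (auto intro!: DERIV_add smooth1.add)
next
  case (mult f g)
  from mult.IH(1) obtain f' where "f' \<in> smooth1" "\<forall>t. (f has_real_derivative f' t) (at t)" ..
  moreover from mult.IH(2) obtain g' where "g' \<in> smooth1" "\<forall>t. (g has_real_derivative g' t) (at t)" ..
  ultimately show ?case using mult.hyps
    by (intro bexI[of _ "\<lambda>t. f' t * g t + g' t * f t"])
       (auto intro!: DERIV_mult smooth1.add smooth1.mult)
qed

text \<open>Writing the components with \<open>h(b := h' b)\<close> makes each of them a product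
  over coordinates again, the form on which the induction in
  \<open>continuously_diff_prod_smooth1\<close> runs.\<close>

lemma GDERIV_prod_coordinates:
  fixes h :: "'a::euclidean_space \<Rightarrow> real \<Rightarrow> real"
  assumes "\<And>b t. b \<in> Basis \<Longrightarrow> (h b has_real_derivative h' b t) (at t)"
  shows "GDERIV (\<lambda>x. \<Prod>b\<in>Basis. h b (x \<bullet> b)) x :>
    (\<Sum>b\<in>Basis. (\<Prod>c\<in>Basis. (h(b := h' b)) c (x \<bullet> c)) *\<^sub>R b)"
proof -
  have "((\<lambda>x. h b (x \<bullet> b)) has_derivative (\<lambda>y. h' b (x \<bullet> b) * (y \<bullet> b))) (at x)"
    if "b \<in> Basis" for b
  proof -
    have "(h b has_derivative (\<lambda>y. h' b (x \<bullet> b) * y)) (at (x \<bullet> b))"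
      using assms[OF that] by (simp add: has_field_derivative_def)
    from has_derivative_compose[OF has_derivative_inner_left[OF has_derivative_ident] this]
    show ?thesis by simp
  qed
  then have "((\<lambda>x. \<Prod>b\<in>Basis. h b (x \<bullet> b)) has_derivative
     (\<lambda>y. \<Sum>b\<in>Basis. h' b (x \<bullet> b) * (y \<bullet> b) * (\<Prod>c\<in>Basis - {b}. h c (x \<bullet> c)))) (at x)"
    by (intro has_derivative_prod)
  moreover have "(\<Sum>b\<in>Basis. h' b (x \<bullet> b) * (y \<bullet> b) * (\<Prod>c\<in>Basis - {b}. h c (x \<bullet> c))) =
     y \<bullet> (\<Sum>b\<in>Basis. (\<Prod>c\<in>Basis. (h(b := h' b)) c (x \<bullet> c)) *\<^sub>R b)" for y
  proof -
    have "(\<Prod>c\<in>Basis. (h(b := h' b)) c (x \<bullet> c)) = h' b (x \<bullet> b) * (\<Prod>c\<in>Basis - {b}. h c (x \<bullet> c))"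
      if "b \<in> Basis" for b
      using that by (subst prod.remove[of _ b]) (auto intro!: prod.cong)
    then show ?thesis
      by (simp add: inner_sum_right mult_ac)
  qed
  ultimately show ?thesis
    by (simp add: gderiv_def)
qed

lemma continuously_diff_prod_smooth1:
  fixes h :: "'a::euclidean_space \<Rightarrow> real \<Rightarrow> real"
  assumes "\<And>b. b \<in> Basis \<Longrightarrow> h b \<in> smooth1"
  shows "continuously_diff k (\<lambda>x. \<Prod>b\<in>Basis. h b (x \<bullet> b))"
  using assms
proof (induction k arbitrary: h)
  case 0
  have "continuous_on UNIV (h b)" if "b \<in> Basis" for b
    using smooth1_deriv[OF 0[OF that]] DERIV_isCont
    by (fastforce intro!: continuous_at_imp_continuous_on)
  then have "continuous_on UNIV (\<lambda>x. h b (x \<bullet> b))" if "b \<in> Basis" for b :: 'a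
    by (rule continuous_on_compose2[OF _ continuous_on_inner[OF continuous_on_id continuous_on_const]])
       (use that in auto)
  then show ?case by (auto intro!: continuous_on_prod)
next
  case (Suc k)
  have "\<forall>b\<in>Basis. \<exists>f'. f' \<in> smooth1 \<and> (\<forall>t. (h b has_real_derivative f' t) (at t))"
    using smooth1_deriv[OF Suc.prems] by blast
  from bchoice[OF this] obtain h' where h': "\<And>b. b \<in> Basis \<Longrightarrow> h' b \<in> smooth1"
      "\<And>b t. b \<in> Basis \<Longrightarrow> (h b has_real_derivative h' b t) (at t)"
    by auto
  let ?g = "\<lambda>x. \<Sum>b\<in>Basis. (\<Prod>c\<in>Basis. (h(b := h' b)) c (x \<bullet> c)) *\<^sub>R b"
  have "continuously_diff k (\<lambda>x. ?g x \<bullet> b)" if "b \<in> Basis" for b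
  proof -
    have "(\<lambda>x. ?g x \<bullet> b) = (\<lambda>x. \<Prod>c\<in>Basis. (h(b := h' b)) c (x \<bullet> c))"
      using that by (simp add: inner_sum_left_Basis del: fun_upd_apply)
    moreover have "continuously_diff k \<dots>"
      using h'(1) Suc.prems by (intro Suc.IH) auto
    ultimately show ?thesis by simp
  qed
  moreover have "GDERIV (\<lambda>x. \<Prod>b\<in>Basis. h b (x \<bullet> b)) x :> ?g x" for x
    by (rule GDERIV_prod_coordinates) (rule h'(2))
  ultimately show ?case
    unfolding continuously_diff.simps by (intro exI[of _ ?g]) blast
qed

text \<open>For t > 0 the factor exp (-1 / (n t)) tends to 1, so these functions converge to the
  indicator of the open box while their supports stay in the closed one. No convolution is
  involved.\<close>

definition bump :: "nat \<Rightarrow> 'a::euclidean_space \<Rightarrow> 'a \<Rightarrow> 'a \<Rightarrow> real" where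
  "bump n a b x = (\<Prod>i\<in>Basis. flat 0 (real n * (x \<bullet> i - a \<bullet> i)) * flat 0 (real n * (b \<bullet> i - x \<bullet> i)))"

lemma bump_nonzero_imp_box: "bump n a b x \<noteq> 0 \<Longrightarrow> x \<in> box a b"
  by (auto simp: bump_def flat_def mem_box zero_less_mult_iff split: if_splits)

lemma flat_0_bounds: "0 \<le> flat 0 t" "flat 0 t \<le> 1"
  by (auto simp: flat_def)

lemma bump_bounds: "0 \<le> bump n a b x" "bump n a b x \<le> 1"
  unfolding bump_def
  by (auto intro!: prod_nonneg prod_le_1 mult_nonneg_nonneg mult_le_one simp: flat_0_bounds)

lemma flat_0_tendsto:
  assumes "t > 0" shows "(\<lambda>n. flat 0 (real n * t)) \<longlonglongrightarrow> 1"
proof -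
  have "(\<lambda>n. exp (- (1 / t) * inverse (real n))) \<longlonglongrightarrow> exp (- (1 / t) * 0)"
    by (intro tendsto_intros LIMSEQ_inverse_real_of_nat tendsto_inverse_0_at_top filterlim_real_sequentially)
  moreover have "eventually (\<lambda>n. exp (- (1 / t) * inverse (real n)) = flat 0 (real n * t)) sequentially"
    using eventually_gt_at_top[of 0]
    by eventually_elim (use assms in \<open>auto simp: flat_def field_simps\<close>)
  ultimately show ?thesis
    using Lim_transform_eventually by fastforce
qed

lemma bump_tendsto: "(\<lambda>n. bump n a b x) \<longlonglongrightarrow> indicator (box a b) x"
proof (cases "x \<in> box a b")
  case True
  then have "(\<lambda>n. bump n a b x) \<longlonglongrightarrow> (\<Prod>i\<in>(Basis::'a set). 1 * 1)"
    unfolding bump_def by (intro tendsto_intros flat_0_tendsto) (auto simp: mem_box)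
  with True show ?thesis by simp
next
  case False
  then have "bump n a b x = 0" for n using bump_nonzero_imp_box by blast
  with False show ?thesis by simp
qed

lemma bump_support: "closure {x. bump n a b x \<noteq> 0} \<subseteq> cbox a b"
  using bump_nonzero_imp_box box_subset_cbox by (intro closure_minimal) fastforce+

lemma bump_test_function:
  assumes "cbox a b \<subseteq> \<Omega>"
  shows "bump n a b \<in> test_functions \<Omega>"
proof -
  have "(\<lambda>t. flat 0 (real n * (t - a \<bullet> i)) * flat 0 (real n * (b \<bullet> i - t))) \<in> smooth1" for i
    using smooth1.mult[OF smooth1.flat[of 1 0 "real n" "- real n * (a \<bullet> i)"]
        smooth1.flat[of 1 0 "- real n" "real n * (b \<bullet> i)"]]
    by (simp add: algebra_simps)
  then have "continuously_diff k (bump n a b)" for k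
    unfolding bump_def by (rule continuously_diff_prod_smooth1)
  moreover have "compact (closure {x. bump n a b x \<noteq> 0})"
    using bump_support by (metis bounded_cbox bounded_subset closed_closure compact_eq_bounded_closed)
  ultimately show ?thesis
    using bump_support assms by (auto simp: test_functions_def) blast
qed

subsection \<open>The fundamental lemma of the calculus of variations\<close>

text \<open>Open boxes form an intersection-stable generator of the Borel sets, so induction over
  disjoint unions and complements extends the vanishing to all of them.\<close>

lemma AE_zero_if_box_integrals_zero:
  fixes g :: "'a::euclidean_space \<Rightarrow> real"
  assumes int: "integrable lborel g"
    and box: "\<And>a b. (LINT x|lborel. indicator (box a b) x * g x) = 0"
  shows "AE x in lborel. g x = 0"
proof (rule sigma_finite_measure.density_zero[OF sigma_finite_lborel int])
  have [measurable]: "g \<in> borel_measurable lborel" using int by auto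
  have si: "set_integrable lborel A g" if "A \<in> sets borel" for A
    unfolding set_integrable_def using int that by (intro integrable_mult_indicator) auto
  \<comment> \<open>The complement case of the induction needs the integral over the whole
    space.\<close>
  have total: "(LINT x|lborel. g x) = 0"
  proof -
    let ?B = "\<lambda>n::nat. box (- (real n *\<^sub>R One)) (real n *\<^sub>R One) :: 'a set"
    have "(\<lambda>n. LINT x|lborel. indicator (?B n) x * g x) \<longlonglongrightarrow> (LINT x|lborel. g x)"
    proof (rule integral_dominated_convergence[where w = "\<lambda>x. norm (g x)"])
      show "AE x in lborel. (\<lambda>n. indicator (?B n) x * g x) \<longlonglongrightarrow> g x"
      proof (rule AE_I2)
        fix x :: 'a
        obtain N where N: "x \<in> ?B N" using UN_box_eq_UNIV by blast
        have "x \<in> ?B n" if "n \<ge> N" for n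
        proof -
          have "x \<bullet> i < real N \<Longrightarrow> x \<bullet> i < real n" "- real N < x \<bullet> i \<Longrightarrow> - real n < x \<bullet> i" for i
            using that by linarith+
          with N show ?thesis by (auto simp: mem_box)
        qed
        then show "(\<lambda>n. indicator (?B n) x * g x) \<longlonglongrightarrow> g x"
          by (intro tendsto_eventually eventually_sequentiallyI[of N]) simp
      qed
    qed (use int in \<open>auto intro!: AE_I2 simp: indicator_def\<close>)
    then show ?thesis by (simp add: box LIMSEQ_const_iff)
  qed
  fix A :: "'a set" assume "A \<in> sets lborel"
  then have A: "A \<in> sigma_sets UNIV (range (\<lambda>(a, b). box a b))"
    by (simp add: borel_eq_box)
  have stable: "Int_stable (range (\<lambda>(a, b). box a b :: 'a set))"
    by (auto simp: Int_stable_def box_Int_box)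
  have "range (\<lambda>(a, b). box a b :: 'a set) \<subseteq> Pow UNIV" by simp
  from stable this A show "set_lebesgue_integral lborel A g = 0"
  proof (induction rule: sigma_sets_induct_disjoint)
    case (basic A)
    then show ?case using box by (auto simp: set_lebesgue_integral_def)
  next
    case empty
    show ?case by (simp add: set_lebesgue_integral_def)
  next
    case (compl A)
    then have A: "A \<in> sets borel" by (simp add: borel_eq_box)
    have "(LINT x:A \<union> (UNIV - A)|lborel. g x) =
        (LINT x:A|lborel. g x) + (LINT x:UNIV - A|lborel. g x)"
      by (intro set_integral_Un si) (use A in auto)
    moreover have "A \<union> (UNIV - A) = UNIV" by auto
    ultimately show ?case
      using compl.IH total by (simp add: set_lebesgue_integral_def)
  next
    case (union A)
    then have A: "A i \<in> sets borel" for i by (auto simp: borel_eq_box)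
    have "(LINT x:(\<Union>i. A i)|lborel. g x) = (\<Sum>i. (LINT x:(A i)|lborel. g x))"
      by (intro lebesgue_integral_countable_add si)
         (use A union.hyps(1) in \<open>auto simp: disjoint_family_on_def\<close>)
    then show ?case using union.IH by simp
  qed
qed

text \<open>Letting n grow in \<open>bump n a b\<close> turns test integrals into box integrals.
  Since d is only locally integrable, this is done inside one closed box of \<Omega> at a time;
  countably many of them cover \<Omega>.\<close>

lemma AE_zero_if_test_integrals_zero:
  fixes d :: "'a::euclidean_space \<Rightarrow> real"
  assumes "open \<Omega>" and loc: "locally_integrable \<Omega> d"
    and test: "\<And>\<phi>. \<phi> \<in> test_functions \<Omega> \<Longrightarrow> (LINT x|lebesgue_on \<Omega>. d x * \<phi> x) = 0"
  shows "AE x in lebesgue_on \<Omega>. d x = 0"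
proof -
  have \<Omega>: "\<Omega> \<in> sets lebesgue" using \<open>open \<Omega>\<close> by auto
  have cbox_int: "integrable lebesgue (\<lambda>x. indicator (cbox a b) x * d x)" if "cbox a b \<subseteq> \<Omega>" for a b
    using loc that by (auto simp: locally_integrable_def set_integrable_def)
  have box_int: "integrable lebesgue (\<lambda>x. indicator (box a b) x * d x)" if "cbox a b \<subseteq> \<Omega>" for a b
  proof -
    have "(\<lambda>x. indicator (box a b) x * d x) =
        (\<lambda>x. indicator (box a b) x *\<^sub>R (indicator (cbox a b) x * d x))"
      using box_subset_cbox[of a b] by (auto simp: indicator_def fun_eq_iff)
    then show ?thesis
      using integrable_mult_indicator[OF _ cbox_int[OF that], of "box a b"] by simp
  qed
  have box_zero: "(LINT x|lebesgue. indicator (box a b) x * d x) = 0" if ab: "cbox a b \<subseteq> \<Omega>" for a b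
  proof -
    have lim: "(\<lambda>n. LINT x|lebesgue. bump n a b x * (indicator (box a b) x * d x))
        \<longlonglongrightarrow> (LINT x|lebesgue. indicator (box a b) x * (indicator (box a b) x * d x))"
    proof (rule integral_dominated_convergence[where w = "\<lambda>x. norm (indicator (box a b) x * d x)"])
      show "AE x in lebesgue. (\<lambda>n. bump n a b x * (indicator (box a b) x * d x))
          \<longlonglongrightarrow> indicator (box a b) x * (indicator (box a b) x * d x)"
        by (intro AE_I2 tendsto_intros bump_tendsto)
      have "continuous_on UNIV (bump n a b)" for n
        using bump_test_function[OF ab, of n] unfolding test_functions_def
        by (metis (mono_tags, lifting) continuously_diff.simps(1) mem_Collect_eq)
      then have [measurable]: "bump n a b \<in> borel_measurable lebesgue" for n
        using borel_measurable_continuous_onI by (intro measurable_completion) auto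
      show "(\<lambda>x. bump n a b x * (indicator (box a b) x * d x)) \<in> borel_measurable lebesgue" for n
        using box_int[OF ab] by measurable
      show "AE x in lebesgue. norm (bump n a b x * (indicator (box a b) x * d x))
          \<le> norm (indicator (box a b) x * d x)" for n
        using bump_bounds[of n a b] by (intro AE_I2) (auto simp: abs_mult intro!: mult_left_le_one_le)
      show "(\<lambda>x. indicator (box a b) x * (indicator (box a b) x * d x)) \<in> borel_measurable lebesgue"
        by (intro borel_measurable_times[OF borel_measurable_indicator
              borel_measurable_integrable[OF box_int[OF ab]]]) auto
    qed (use box_int[OF ab] in auto)
    have "(LINT x|lebesgue. bump n a b x * (indicator (box a b) x * d x)) = 0" for n
    proof -
      have "(LINT x|lebesgue. bump n a b x * (indicator (box a b) x * d x)) =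
          (LINT x|lebesgue. indicator \<Omega> x *\<^sub>R (d x * bump n a b x))"
        using ab bump_nonzero_imp_box[of n a b] box_subset_cbox[of a b]
        by (intro Bochner_Integration.integral_cong) (auto simp: indicator_def)
      also have "\<dots> = (LINT x|lebesgue_on \<Omega>. d x * bump n a b x)"
        using \<Omega> by (subst integral_restrict_space) auto
      finally show ?thesis using test bump_test_function[OF ab] by simp
    qed
    with lim show ?thesis
      by (simp add: LIMSEQ_const_iff mult.assoc[symmetric] flip: indicator_inter_arith)
  qed
  have cbox_AE: "AE x in lebesgue. x \<in> cbox a b \<longrightarrow> d x = 0" if ab: "cbox a b \<subseteq> \<Omega>" for a b
  proof -
    \<comment> \<open>The lemma on box integrals speaks of \<open>lborel\<close>, so d is cut off to
      the box and replaced by a Borel version.\<close>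
    let ?g = "\<lambda>x. indicator (box a b) x * d x"
    obtain g where [measurable]: "g \<in> borel_measurable lborel" and g: "AE x in lborel. ?g x = g x"
      using completion_ex_borel_measurable_real[of ?g lborel] box_int[OF ab] by auto
    have g': "AE x in lebesgue. ?g x = g x" using g by (rule AE_completion)
    have gm: "g \<in> borel_measurable lebesgue" by (intro measurable_completion) simp
    have "integrable lebesgue g"
      using box_int[OF ab] g' gm by (subst integrable_cong_AE[of _ _ ?g]) auto
    then have gi: "integrable lborel g" by (simp add: integrable_completion)
    have "AE x in lborel. g x = 0"
    proof (rule AE_zero_if_box_integrals_zero[OF gi])
      fix u v :: 'a
      \<comment> \<open>The closed box of the intersection stays inside \<open>cbox a b\<close>,
        hence inside \<Omega>, so \<open>box_zero\<close> applies to it.\<close>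
      obtain s t where st: "box u v \<inter> box a b = box s t" "cbox u v \<inter> cbox a b = cbox s t"
        by (simp add: box_Int_box Int_interval)
      have "(LINT x|lborel. indicator (box u v) x * g x) = (LINT x|lebesgue. indicator (box u v) x * g x)"
        by (subst integral_completion) auto
      also have "\<dots> = (LINT x|lebesgue. indicator (box u v) x * ?g x)"
        using g' by (intro integral_cong_AE borel_measurable_times[OF borel_measurable_indicator gm]
            borel_measurable_times[OF borel_measurable_indicator
              borel_measurable_integrable[OF box_int[OF ab]]]) auto
      also have "\<dots> = (LINT x|lebesgue. indicator (box s t) x * d x)"
        by (simp add: mult.assoc[symmetric] st(1)[symmetric] indicator_inter_arith)
      also have "\<dots> = 0" using st(2) ab by (intro box_zero) auto
      finally show "(LINT x|lborel. indicator (box u v) x * g x) = 0" .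
    qed
    then have "AE x in lebesgue. g x = 0" by (rule AE_completion)
    moreover have "AE x in lebesgue. x \<notin> cbox a b - box a b"
      using negligible_frontier_interval[of a b] unfolding negligible_iff_null_sets by (rule AE_not_in)
    ultimately show ?thesis using g'
      by eventually_elim (auto simp: indicator_def split: if_splits)
  qed
  obtain \<D> where D: "countable \<D>" "\<D> \<subseteq> Pow \<Omega>" "\<And>X. X \<in> \<D> \<Longrightarrow> \<exists>a b. X = cbox a b" "\<Union>\<D> = \<Omega>"
    using open_countable_Union_open_cbox[OF \<open>open \<Omega>\<close>] by blast
  have "\<forall>X\<in>\<D>. AE x in lebesgue. x \<in> X \<longrightarrow> d x = 0"
    using D(2,3) cbox_AE by blast
  then have "AE x in lebesgue. \<forall>X\<in>\<D>. x \<in> X \<longrightarrow> d x = 0"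
    by (rule AE_ball_countable[THEN iffD2, OF D(1)])
  then show ?thesis
    using \<Omega> D(4) by (subst AE_restrict_space_iff) auto
qed

subsection \<open>Riesz representation in \<open>L\<^sup>2\<close>\<close>

text \<open>Covers real functions (for X) and vector fields (for Y) at once; \<open>sq_int\<close>
  is the squared norm.\<close>

definition sq_integrable :: "'a measure \<Rightarrow> ('a \<Rightarrow> 'b::euclidean_space) \<Rightarrow> bool" where
  "sq_integrable M v \<longleftrightarrow> v \<in> borel_measurable M \<and> integrable M (\<lambda>x. (norm (v x))\<^sup>2)"

definition sq_int :: "'a measure \<Rightarrow> ('a \<Rightarrow> 'b::euclidean_space) \<Rightarrow> real" where
  "sq_int M v = (LINT x|M. (norm (v x))\<^sup>2)"

lemma sq_integrable_inner:
  assumes "sq_integrable M v" "sq_integrable M w"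
  shows "integrable M (\<lambda>x. v x \<bullet> w x)"
proof (rule Bochner_Integration.integrable_bound)
  show "integrable M (\<lambda>x. (norm (v x))\<^sup>2 + (norm (w x))\<^sup>2)"
    using assms by (auto simp: sq_integrable_def)
  show "(\<lambda>x. v x \<bullet> w x) \<in> borel_measurable M"
    using assms by (auto simp: sq_integrable_def)
  show "AE x in M. norm (v x \<bullet> w x) \<le> norm ((norm (v x))\<^sup>2 + (norm (w x))\<^sup>2)"
  proof (rule AE_I2)
    fix x
    have "\<bar>v x \<bullet> w x\<bar> \<le> norm (v x) * norm (w x)" by (rule Cauchy_Schwarz_ineq2)
    also have "\<dots> \<le> (norm (v x))\<^sup>2 + (norm (w x))\<^sup>2"
      using sum_squares_bound[of "norm (v x)" "norm (w x)"]
        mult_nonneg_nonneg[OF norm_ge_zero[of "v x"] norm_ge_zero[of "w x"]] by linarith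
    finally show "norm (v x \<bullet> w x) \<le> norm ((norm (v x))\<^sup>2 + (norm (w x))\<^sup>2)" by simp
  qed
qed

lemma norm_sq_add: "(norm (v + w :: 'b::real_inner))\<^sup>2 = (norm v)\<^sup>2 + 2 * (v \<bullet> w) + (norm w)\<^sup>2"
  by (simp add: power2_norm_eq_inner inner_simps inner_commute)

lemma sq_integrable_add:
  assumes "sq_integrable M v" "sq_integrable M w"
  shows "sq_integrable M (\<lambda>x. v x + w x)"
    and "sq_int M (\<lambda>x. v x + w x) = sq_int M v + 2 * (LINT x|M. v x \<bullet> w x) + sq_int M w"
  using sq_integrable_inner[OF assms] assms
  by (auto simp: sq_integrable_def sq_int_def norm_sq_add)

lemma sq_integrable_scaleR:
  assumes "sq_integrable M v"
  shows "sq_integrable M (\<lambda>x. c *\<^sub>R v x)" and "sq_int M (\<lambda>x. c *\<^sub>R v x) = c\<^sup>2 * sq_int M v"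
  using assms by (auto simp: sq_integrable_def sq_int_def power_mult_distrib)

lemma sq_integrable_diff:
  assumes "sq_integrable M v" "sq_integrable M w"
  shows "sq_integrable M (\<lambda>x. v x - w x)"
    and "sq_int M (\<lambda>x. v x - w x) = sq_int M v - 2 * (LINT x|M. v x \<bullet> w x) + sq_int M w"
  using sq_integrable_add[OF assms(1) sq_integrable_scaleR(1)[OF assms(2), of "-1"]]
    sq_integrable_scaleR(2)[OF assms(2), of "-1"] by simp_all

lemma sq_int_nonneg: "sq_int M v \<ge> 0"
  by (simp add: sq_int_def)

lemma sq_int_diff_commute: "sq_int M (\<lambda>x. v x - w x) = sq_int M (\<lambda>x. w x - v x)"
  by (simp add: sq_int_def norm_minus_commute)

lemma nn_integral_sq_int:
  "sq_integrable M v \<Longrightarrow> (\<integral>\<^sup>+x. ennreal ((norm (v x))\<^sup>2) \<partial>M) = ennreal (sq_int M v)"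
  unfolding sq_integrable_def sq_int_def by (intro nn_integral_eq_integral) auto

text \<open>A weighted form of the Cauchy-Schwarz inequality is enough, and it avoids division by a
  norm that may vanish.\<close>

lemma sq_int_inner_tendsto:
  assumes s: "\<And>n::nat. sq_integrable M (s n)" and d: "sq_integrable M d" and u: "sq_integrable M u"
    and lim: "(\<lambda>n. sq_int M (\<lambda>x. s n x - d x)) \<longlonglongrightarrow> 0"
  shows "(\<lambda>n. LINT x|M. s n x \<bullet> u x) \<longlonglongrightarrow> (LINT x|M. d x \<bullet> u x)"
proof -
  have bound: "\<bar>LINT x|M. w x \<bullet> u x\<bar> \<le> e * sq_int M u + sq_int M w / e"
    if w: "sq_integrable M w" and e: "e > 0" for w e
  proof -
    have "2 * \<bar>LINT x|M. w x \<bullet> u x\<bar> \<le> e * sq_int M u + sq_int M w / e"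
    proof -
      \<comment> \<open>The weights come from expanding the square of sqrt e u + (\<sigma> / sqrt e)
        w; the two signs of \<sigma> give the absolute value.\<close>
      let ?c = "sqrt e"
      have c: "?c * ?c = e" "?c > 0" using e by auto
      have *: "0 \<le> e * sq_int M u + 2 * \<sigma> * (LINT x|M. w x \<bullet> u x) + sq_int M w / e"
        if "\<sigma>\<^sup>2 = 1" for \<sigma> :: real
      proof -
        have "0 \<le> sq_int M (\<lambda>x. ?c *\<^sub>R u x + (\<sigma> / ?c) *\<^sub>R w x)" by (rule sq_int_nonneg)
        also have "\<dots> = e * sq_int M u + 2 * (LINT x|M. (?c *\<^sub>R u x) \<bullet> ((\<sigma> / ?c) *\<^sub>R w x)) + sq_int M w / e"
          using e that by (simp add: sq_integrable_add(2) sq_integrable_scaleR u w power_divide)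
        also have "(LINT x|M. (?c *\<^sub>R u x) \<bullet> ((\<sigma> / ?c) *\<^sub>R w x)) = (LINT x|M. \<sigma> * (w x \<bullet> u x))"
          using c by (intro Bochner_Integration.integral_cong) (auto simp: inner_commute)
        finally show ?thesis by simp
      qed
      from *[of 1] *[of "-1"] show ?thesis by simp
    qed
    then show ?thesis by linarith
  qed
  show ?thesis
  proof (rule LIMSEQ_I)
    fix r :: real assume r: "r > 0"
    \<comment> \<open>Makes the first term of \<open>bound\<close> at most r / 2; the + 1 covers u =
      0.\<close>
    define e where "e = r / (2 * (sq_int M u + 1))"
    have u0: "sq_int M u \<ge> 0" by (rule sq_int_nonneg)
    have e: "e > 0" using r u0 by (auto simp: e_def intro!: divide_pos_pos)
    have eu: "e * sq_int M u \<le> r / 2" using r u0 by (auto simp: e_def field_simps)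
    obtain N where N: "\<And>n. n \<ge> N \<Longrightarrow> norm (sq_int M (\<lambda>x. s n x - d x) - 0) < e * r / 2"
      using LIMSEQ_D[OF lim, of "e * r / 2"] e r by auto
    show "\<exists>no. \<forall>n\<ge>no. norm ((LINT x|M. s n x \<bullet> u x) - (LINT x|M. d x \<bullet> u x)) < r"
    proof (intro exI allI impI)
      fix n assume "n \<ge> N"
      then have "sq_int M (\<lambda>x. s n x - d x) / e < r / 2"
        using N[of n] e by (auto simp: field_simps)
      moreover have "(LINT x|M. s n x \<bullet> u x) - (LINT x|M. d x \<bullet> u x) = (LINT x|M. (s n x - d x) \<bullet> u x)"
        using s d u by (simp add: inner_diff_left sq_integrable_inner)
      ultimately show "norm ((LINT x|M. s n x \<bullet> u x) - (LINT x|M. d x \<bullet> u x)) < r"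
        using bound[OF sq_integrable_diff(1)[OF s d] e, of n] eu unfolding real_norm_def by linarith
    qed
  qed
qed

text \<open>The Riesz-Fischer argument with a prescribed rate: the increments are summable in L^1,
  so the sequence converges almost everywhere, and Fatou's lemma carries the Cauchy estimate over to
  the limit. The rate (1/8)^n leaves (1/4)^n after the loss of a factor 2^n in
  \<open>pt\<close>.\<close>

lemma L2_limit_of_fast_Cauchy:
  fixes s :: "nat \<Rightarrow> 'a \<Rightarrow> 'b::euclidean_space"
  assumes "finite_measure M" and s: "\<And>n. sq_integrable M (s n)"
    and cau: "\<And>n k. n \<le> k \<Longrightarrow> sq_int M (\<lambda>x. s n x - s k x) \<le> (1/8) ^ n"
  obtains d where "sq_integrable M d" "(\<lambda>n. sq_int M (\<lambda>x. s n x - d x)) \<longlonglongrightarrow> 0"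
proof -
  interpret finite_measure M by fact
  have [measurable]: "s n \<in> borel_measurable M" for n using s by (simp add: sq_integrable_def)
  define w where "w n x = norm (s (Suc n) x - s n x)" for n x
  have [measurable]: "w n \<in> borel_measurable M" for n unfolding w_def by measurable
  let ?C = "measure M (space M) + 1"
  have w_int: "(\<integral>\<^sup>+x. ennreal (w n x) \<partial>M) \<le> ennreal (?C * (1/2) ^ n)" for n
  proof -
    have diff: "sq_integrable M (\<lambda>x. s (Suc n) x - s n x)" by (intro sq_integrable_diff s)
    \<comment> \<open>This is y <= y^2 + 1 at y = 2^n w, divided by 2^n; the constant term is
      integrable because the measure is finite.\<close>
    have pt: "w n x \<le> (1/2)^n + 2 ^ n * (w n x)\<^sup>2" for x
    proof -
      have "2 * (w n x * 2 ^ n) \<le> (w n x * 2 ^ n)\<^sup>2 + 1"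
        using sum_squares_bound[of "w n x * 2 ^ n" 1] by simp
      moreover have "w n x \<ge> 0" by (simp add: w_def)
      then have "0 \<le> w n x * 2 ^ n" by simp
      ultimately have "w n x * 2 ^ n \<le> (w n x * 2 ^ n)\<^sup>2 + 1" by linarith
      then have "w n x * 2 ^ n * (1/2)^n \<le> ((w n x * 2 ^ n)\<^sup>2 + 1) * (1/2)^n"
        by (intro mult_right_mono) auto
      then show ?thesis
        by (simp add: field_simps power2_eq_square)
    qed
    have "(\<integral>\<^sup>+x. ennreal (w n x) \<partial>M) \<le> (\<integral>\<^sup>+x. ennreal ((1/2)^n + 2 ^ n * (w n x)\<^sup>2) \<partial>M)"
      by (intro nn_integral_mono ennreal_leI pt)
    also have "\<dots> = ennreal (LINT x|M. (1/2)^n + 2 ^ n * (w n x)\<^sup>2)"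
      using diff by (intro nn_integral_eq_integral) (auto simp: sq_integrable_def w_def)
    also have "(LINT x|M. (1/2)^n + 2 ^ n * (w n x)\<^sup>2) =
        measure M (space M) * (1/2)^n + 2 ^ n * sq_int M (\<lambda>x. s n x - s (Suc n) x)"
      using diff by (subst sq_int_diff_commute) (simp add: sq_integrable_def w_def sq_int_def)
    also have "\<dots> \<le> measure M (space M) * (1/2)^n + 2 ^ n * (1/8) ^ n"
      using cau[of n "Suc n"] by simp
    also have "2 ^ n * (1/8) ^ n = ((1/4) ^ n :: real)"
      by (simp flip: power_mult_distrib)
    also have "(1/4) ^ n \<le> ((1/2) ^ n :: real)" by (intro power_mono) auto
    finally show ?thesis by (simp add: algebra_simps ennreal_leI)
  qed
  have "(\<integral>\<^sup>+x. (\<Sum>n. ennreal (w n x)) \<partial>M) = (\<Sum>n. \<integral>\<^sup>+x. ennreal (w n x) \<partial>M)"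
    by (intro nn_integral_suminf) measurable
  also have "\<dots> \<le> (\<Sum>n. ennreal (?C * (1/2) ^ n))"
    by (intro suminf_le w_int) auto
  also have "\<dots> = ennreal (\<Sum>n. ?C * (1/2) ^ n)"
    by (intro suminf_ennreal2 summable_mult summable_geometric) auto
  finally have "(\<integral>\<^sup>+x. (\<Sum>n. ennreal (w n x)) \<partial>M) \<noteq> \<infinity>"
    by (metis ennreal_neq_top infinity_ennreal_def neq_top_trans)
  then have "AE x in M. (\<Sum>n. ennreal (w n x)) \<noteq> \<infinity>"
    by (intro nn_integral_PInf_AE) measurable
  then have conv: "AE x in M. (\<lambda>n. s n x) \<longlonglongrightarrow> lim (\<lambda>n. s n x)"
  proof eventually_elim
    case (elim x)
    then have "summable (\<lambda>n. w n x)"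
      by (intro summable_suminf_not_top) (auto simp: w_def)
    then have "summable (\<lambda>n. s (Suc n) x - s n x)"
      unfolding w_def by (rule summable_norm_cancel)
    then have "convergent (\<lambda>n. \<Sum>i<n. s (Suc i) x - s i x)"
      by (simp add: summable_iff_convergent)
    then have "convergent (\<lambda>n. s n x - s 0 x)" by (simp only: sum_lessThan_telescope[of "\<lambda>i. s i x"])
    then have "convergent (\<lambda>n. (s n x - s 0 x) + s 0 x)"
      by (intro convergent_add convergent_const)
    then show ?case by (simp add: convergent_LIMSEQ_iff)
  qed
  define d where "d x = lim (\<lambda>n. s n x)" for x
  have [measurable]: "d \<in> borel_measurable M"
    unfolding d_def by measurable
  have bound: "(\<integral>\<^sup>+x. ennreal ((norm (s n x - d x))\<^sup>2) \<partial>M) \<le> ennreal ((1/8)^n)" for n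
  proof -
    have "(\<integral>\<^sup>+x. ennreal ((norm (s n x - d x))\<^sup>2) \<partial>M) =
        (\<integral>\<^sup>+x. liminf (\<lambda>k. ennreal ((norm (s n x - s k x))\<^sup>2)) \<partial>M)"
    proof (rule nn_integral_cong_AE, use conv in eventually_elim)
      case (elim x)
      then have "(\<lambda>k. ennreal ((norm (s n x - s k x))\<^sup>2)) \<longlonglongrightarrow> ennreal ((norm (s n x - d x))\<^sup>2)"
        unfolding d_def by (intro tendsto_intros)
      then show ?case using lim_imp_Liminf[OF sequentially_bot] by metis
    qed
    also have "\<dots> \<le> liminf (\<lambda>k. \<integral>\<^sup>+x. ennreal ((norm (s n x - s k x))\<^sup>2) \<partial>M)"
      by (intro nn_integral_liminf) measurable
    also have "\<dots> \<le> ennreal ((1/8)^n)"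
    proof (rule Liminf_le)
      show "\<forall>\<^sub>F k in sequentially. (\<integral>\<^sup>+x. ennreal ((norm (s n x - s k x))\<^sup>2) \<partial>M) \<le> ennreal ((1/8)^n)"
        using eventually_ge_at_top[of n]
        by eventually_elim (use cau in \<open>simp add: nn_integral_sq_int sq_integrable_diff(1) s ennreal_leI\<close>)
    qed simp
    finally show ?thesis .
  qed
  have sd: "sq_integrable M (\<lambda>x. s n x - d x)" for n
    unfolding sq_integrable_def
  proof (intro conjI integrableI_bounded)
    have "(\<integral>\<^sup>+x. ennreal (norm ((norm (s n x - d x))\<^sup>2)) \<partial>M) \<le> ennreal ((1/8)^n)"
      using bound[of n] by simp
    also have "\<dots> < \<infinity>" by simp
    finally show "(\<integral>\<^sup>+x. ennreal (norm ((norm (s n x - d x))\<^sup>2)) \<partial>M) < \<infinity>" .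
  qed measurable
  have "sq_int M (\<lambda>x. s n x - d x) \<le> (1/8)^n" for n
    using bound[of n] by (simp add: nn_integral_sq_int[OF sd] ennreal_le_iff)
  then have "(\<lambda>n. sq_int M (\<lambda>x. s n x - d x)) \<longlonglongrightarrow> 0"
    by (intro tendsto_sandwich[OF _ _ tendsto_const LIMSEQ_power_zero[of "1/8::real"]])
       (auto simp: sq_int_nonneg)
  moreover have "sq_integrable M d"
    using sq_integrable_diff(1)[OF s[of 0] sd[of 0]] by simp
  ultimately show thesis using that by simp
qed

text \<open>A minimizing sequence of \<open>B \<parallel>v\<parallel>\<^sup>2 - l v\<close> over \<open>V\<close> is Cauchy by the parallelogram law.\<close>
lemma L2_Riesz_on_subspace:
  fixes V :: "('a \<Rightarrow> 'b::euclidean_space) set" and l :: "('a \<Rightarrow> 'b) \<Rightarrow> real"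
  assumes fin: "finite_measure M" and V: "\<And>v. v \<in> V \<Longrightarrow> sq_integrable M v" and "V \<noteq> {}"
    and add: "\<And>v w. v \<in> V \<Longrightarrow> w \<in> V \<Longrightarrow> (\<lambda>x. v x + w x) \<in> V"
    and scale: "\<And>c v. v \<in> V \<Longrightarrow> (\<lambda>x. c *\<^sub>R v x) \<in> V"
    and ladd: "\<And>v w. v \<in> V \<Longrightarrow> w \<in> V \<Longrightarrow> l (\<lambda>x. v x + w x) = l v + l w"
    and lscale: "\<And>c v. v \<in> V \<Longrightarrow> l (\<lambda>x. c *\<^sub>R v x) = c * l v"
    and B: "B > 0" and bound: "\<And>v. v \<in> V \<Longrightarrow> l v \<le> A + B * sq_int M v"
  obtains d s where "sq_integrable M d" "\<And>n::nat. s n \<in> V"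
    "(\<lambda>n. sq_int M (\<lambda>x. s n x - d x)) \<longlonglongrightarrow> 0"
    "\<And>u. u \<in> V \<Longrightarrow> l u = 2 * B * (LINT x|M. d x \<bullet> u x)"
proof -
  define J where "J v = B * sq_int M v - l v" for v
  define m where "m = Inf (J ` V)"
  have bdd: "bdd_below (J ` V)" 
    using bound by (intro bdd_belowI[of _ "- A"]) (force simp: J_def)
  have m: "m \<le> J v" if "v \<in> V" for v unfolding m_def using bdd that by (intro cInf_lower) auto
  have "\<exists>v\<in>V. J v < m + e" if "e > 0" for e
    using cInf_lessD[of "J ` V" "m + e"] \<open>V \<noteq> {}\<close> that by (auto simp: m_def)
  \<comment> \<open>The slack is chosen so that the factor 2 / B in \<open>para\<close> turns it
    into the rate (1/8)^n.\<close>
  then have "\<exists>v. v \<in> V \<and> J v < m + B / 4 * (1/8)^n" for n :: nat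
    using B by (metis divide_pos_pos mult_pos_pos zero_less_numeral zero_less_power zero_less_one)
  then obtain s where sV: "\<And>n. s n \<in> V" and s: "\<And>n. J (s n) < m + B / 4 * (1/8)^n" by metis
  have para: "sq_int M (\<lambda>x. v x - w x) \<le> 2 / B * (J v + J w - 2 * m)" if vw: "v \<in> V" "w \<in> V" for v w
  proof -
    have mid: "(\<lambda>x. (1/2) *\<^sub>R (v x + w x)) \<in> V" by (intro scale add vw)
    have sum: "sq_integrable M (\<lambda>x. v x + w x)" by (intro V add vw)
    have "2 * J (\<lambda>x. (1/2) *\<^sub>R (v x + w x)) = J v + J w - B / 2 * sq_int M (\<lambda>x. v x - w x)"
    proof -
      have L: "l (\<lambda>x. (1/2) *\<^sub>R (v x + w x)) = (1/2) * (l v + l w)"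
        using lscale[OF add[OF vw]] ladd[OF vw] by simp
      have S: "sq_int M (\<lambda>x. (1/2) *\<^sub>R (v x + w x)) =
          (1/4) * (sq_int M v + 2 * (LINT x|M. v x \<bullet> w x) + sq_int M w)"
        using sq_integrable_scaleR(2)[OF sum, of "1/2"] sq_integrable_add(2)[OF V V, OF vw]
        by (simp add: power2_eq_square)
      show ?thesis
        unfolding J_def L S sq_integrable_diff(2)[OF V V, OF vw] by (simp add: field_simps)
    qed
    with m[OF mid] have "B / 2 * sq_int M (\<lambda>x. v x - w x) \<le> J v + J w - 2 * m" by linarith
    with B show ?thesis by (simp add: field_simps)
  qed
  have cau: "sq_int M (\<lambda>x. s n x - s k x) \<le> (1/8)^n" if "n \<le> k" for n k
  proof -
    have "((1/8::real)) ^ k \<le> (1/8)^n" using that by (intro power_decreasing) auto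
    then have "B / 4 * (1/8)^k \<le> B / 4 * (1/8)^n" using B by simp
    then have "J (s n) + J (s k) - 2 * m \<le> B / 2 * (1/8)^n" using s[of n] s[of k] by linarith
    then have "2 / B * (J (s n) + J (s k) - 2 * m) \<le> 2 / B * (B / 2 * (1/8)^n)"
      using B by (intro mult_left_mono) auto
    with para[OF sV sV, of n k] B show ?thesis by simp
  qed
  obtain d where d: "sq_integrable M d" and lim: "(\<lambda>n. sq_int M (\<lambda>x. s n x - d x)) \<longlonglongrightarrow> 0"
    by (rule L2_limit_of_fast_Cauchy[OF fin V[OF sV] cau])
  have "l u = 2 * B * (LINT x|M. d x \<bullet> u x)" if u: "u \<in> V" for u
  proof -
    define q where "q = 2 * B * (LINT x|M. d x \<bullet> u x) - l u"
    have inner_lim: "(\<lambda>n. LINT x|M. s n x \<bullet> u x) \<longlonglongrightarrow> (LINT x|M. d x \<bullet> u x)"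
      by (intro sq_int_inner_tendsto V sV d u lim)
    \<comment> \<open>First variation: m <= J (s n + t u) for every t, expanded in t and passed to
      the limit in n.\<close>
    have pos: "0 \<le> t * q + t\<^sup>2 * (B * sq_int M u)" for t
    proof (rule LIMSEQ_le_const)
      let ?f = "\<lambda>n. B / 4 * (1/8)^n + t * (2 * B * (LINT x|M. s n x \<bullet> u x) - l u) + t\<^sup>2 * (B * sq_int M u)"
      have "?f \<longlonglongrightarrow> B / 4 * 0 + t * q + t\<^sup>2 * (B * sq_int M u)"
        unfolding q_def by (intro tendsto_intros inner_lim LIMSEQ_power_zero) auto
      then show "?f \<longlonglongrightarrow> t * q + t\<^sup>2 * (B * sq_int M u)" by simp
      have "0 \<le> ?f n" for n
      proof -
        have "m \<le> J (\<lambda>x. s n x + t *\<^sub>R u x)" by (intro m add scale sV u)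
        also have "\<dots> = J (s n) + t * (2 * B * (LINT x|M. s n x \<bullet> u x) - l u) + t\<^sup>2 * (B * sq_int M u)"
          using V[OF u] V[OF sV[of n]] sV u scale[OF u, of t]
          by (simp add: J_def ladd lscale sq_integrable_add(2) sq_integrable_scaleR algebra_simps)
        finally show ?thesis using s[of n] by linarith
      qed
      then show "\<exists>N. \<forall>n\<ge>N. 0 \<le> ?f n" by blast
    qed
    have "q = 0"
    proof (rule ccontr)
      assume "q \<noteq> 0"
      \<comment> \<open>The + 1 makes the quadratic strictly negative at t = - q / c, where its
        value is at most - q^2 / c^2.\<close>
      define c where "c = B * sq_int M u + 1"
      have c: "c \<ge> 1" using B sq_int_nonneg[of M u] by (simp add: c_def)
      have "0 \<le> (- q / c) * q + (- q / c)\<^sup>2 * (c - 1)" using pos[of "- q / c"] by (simp add: c_def)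
      also have "\<dots> = - q\<^sup>2 / c\<^sup>2" using c by (simp add: power2_eq_square field_simps)
      finally show False using \<open>q \<noteq> 0\<close> c by (simp add: field_simps)
    qed
    then show ?thesis by (simp add: q_def)
  qed
  \<comment> \<open>d need not belong to V, so the approximating sequence is exported as well;
    \<open>X_dense_L2\<close> relies on it.\<close>
  then show thesis by (rule that[OF d sV lim])
qed

subsection \<open>Integration by parts for test functions\<close>

lemma GDERIV_unique: "GDERIV f x :> a \<Longrightarrow> GDERIV f x :> b \<Longrightarrow> a = b"
  unfolding gderiv_def by (metis has_derivative_unique inner_commute vector_eq_ldot)

lemma grad_eqI: "GDERIV f x :> a \<Longrightarrow> grad f x = a"
  unfolding grad_def using GDERIV_unique by blast

lemma GDERIV_isCont: "GDERIV f x :> a \<Longrightarrow> isCont f x"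
  unfolding gderiv_def by (rule has_derivative_continuous)

lemma test_function_C1:
  assumes "\<phi> \<in> test_functions \<Omega>"
  shows "GDERIV \<phi> x :> grad \<phi> x" and "continuous_on UNIV \<phi>" and "continuous_on UNIV (grad \<phi>)"
proof -
  have "continuously_diff (Suc 0) \<phi>" using assms unfolding test_functions_def by blast
  then obtain g where g: "\<And>x. GDERIV \<phi> x :> g x"
      "\<And>b. b \<in> Basis \<Longrightarrow> continuous_on UNIV (\<lambda>x. g x \<bullet> b)" by auto
  have "grad \<phi> = g" using grad_eqI[OF g(1)] by auto
  moreover have "continuous_on UNIV (\<lambda>x. \<Sum>b\<in>Basis. (g x \<bullet> b) *\<^sub>R b)"
    by (intro continuous_intros g(2)) auto
  ultimately show "GDERIV \<phi> x :> grad \<phi> x" "continuous_on UNIV \<phi>" "continuous_on UNIV (grad \<phi>)"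
    using g(1) GDERIV_isCont by (auto simp: euclidean_representation intro!: continuous_at_imp_continuous_on)
qed

lemma test_function_support:
  assumes "\<phi> \<in> test_functions \<Omega>"
  shows "\<exists>K. compact K \<and> K \<subseteq> \<Omega> \<and> (\<forall>x. x \<notin> K \<longrightarrow> \<phi> x = 0 \<and> grad \<phi> x = 0)"
proof -
  define K where "K = closure {x. \<phi> x \<noteq> 0}"
  have K: "compact K" "K \<subseteq> \<Omega>" using assms unfolding test_functions_def K_def by blast+
  have z: "\<phi> x = 0" if "x \<notin> K" for x
    using that closure_subset[of "{x. \<phi> x \<noteq> 0}"] unfolding K_def by blast
  have "grad \<phi> x = 0" if "x \<notin> K" for x
  proof (rule grad_eqI)
    have "((\<lambda>_. 0) has_derivative (\<lambda>h. h \<bullet> 0)) (at x)" by simp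
    then have "(\<phi> has_derivative (\<lambda>h. h \<bullet> 0)) (at x)"
      by (rule has_derivative_transform_within_open[where s = "- K"])
         (use that z K(1) in \<open>auto simp: compact_imp_closed open_Compl\<close>)
    then show "GDERIV \<phi> x :> 0" unfolding gderiv_def .
  qed
  with K z show ?thesis by blast
qed

lemma compact_support_bounded:
  fixes f :: "'a::euclidean_space \<Rightarrow> 'b::euclidean_space"
  assumes "compact K" "continuous_on UNIV f" "\<And>x. x \<notin> K \<Longrightarrow> f x = 0"
  obtains B where "B > 0" "\<And>x. norm (f x) \<le> B"
proof -
  have "bounded (f ` K)"
    using assms by (meson compact_continuous_image compact_imp_bounded continuous_on_subset subset_UNIV)
  then obtain B where B: "B > 0" "\<And>x. x \<in> K \<Longrightarrow> norm (f x) \<le> B"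
    unfolding bounded_pos by blast
  show thesis by (rule that[OF B(1)]) (use assms(3) B in fastforce)
qed

lemma compact_support_integrable:
  fixes f :: "'a::euclidean_space \<Rightarrow> 'b::euclidean_space"
  assumes "compact K" "continuous_on UNIV f" "\<And>x. x \<notin> K \<Longrightarrow> f x = 0"
  shows "integrable lborel f"
proof -
  have "(\<lambda>x. indicator K x *\<^sub>R f x) = f" using assms(3) by (auto simp: indicator_def)
  then show ?thesis
    using borel_integrable_compact[OF assms(1) continuous_on_subset[OF assms(2)]] by simp
qed

text \<open>Difference quotients integrate to zero by translation invariance, so no Fubini argument is needed.\<close>
lemma integral_directional_derivative_zero:
  fixes h :: "'a::euclidean_space \<Rightarrow> real"
  assumes K: "compact K" "\<And>x. x \<notin> K \<Longrightarrow> h x = 0" "\<And>x. x \<notin> K \<Longrightarrow> g x = 0"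
    and g: "\<And>x. GDERIV h x :> g x" "continuous_on UNIV g" and b: "norm b = 1"
  shows "(LINT x|lborel. g x \<bullet> b) = 0"
proof -
  have cont_h: "continuous_on UNIV h"
    using g(1) GDERIV_isCont by (auto intro!: continuous_at_imp_continuous_on)
  then have hm [measurable]: "h \<in> borel_measurable borel" by (rule borel_measurable_continuous_onI)
  have gm [measurable]: "g \<in> borel_measurable borel" using g(2) by (rule borel_measurable_continuous_onI)
  obtain B where B: "B > 0" "\<And>x. norm (g x) \<le> B" using compact_support_bounded[OF K(1) g(2) K(3)] by blast
  obtain R where R: "\<And>x. x \<in> K \<Longrightarrow> norm x \<le> R" using compact_imp_bounded[OF K(1)] unfolding bounded_iff by blast
  define e :: "nat \<Rightarrow> real" where "e n = inverse (real (Suc n))" for n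
  have e: "0 < e n" "e n \<le> 1" for n by (auto simp: e_def field_simps)
  have lip: "\<bar>h y - h x\<bar> \<le> B * norm (y - x)" for x y
  proof -
    have "norm (h y - h x) \<le> B * norm (y - x)"
    proof (rule differentiable_bound[of UNIV])
      show "(h has_derivative (\<lambda>v. v \<bullet> g z)) (at z within UNIV)" for z
        using g(1)[of z] by (simp add: gderiv_def)
      show "onorm (\<lambda>v. v \<bullet> g z) \<le> B" for z
      proof (rule onorm_le)
        fix v show "norm (v \<bullet> g z) \<le> B * norm v"
          using Cauchy_Schwarz_ineq2[of v "g z"] mult_left_mono[OF B(2)[of z], of "norm v"]
          by (simp add: mult.commute)
      qed
    qed auto
    then show ?thesis by simp
  qed
  let ?q = "\<lambda>n x. (h (x + e n *\<^sub>R b) - h x) / e n"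
  have "(\<lambda>n. LINT x|lborel. ?q n x) \<longlonglongrightarrow> (LINT x|lborel. g x \<bullet> b)"
  \<comment> \<open>As e n <= 1, all difference quotients are supported in the ball of radius R + 1,
    and the Lipschitz constant B bounds them there.\<close>
  proof (rule integral_dominated_convergence[where w = "\<lambda>x. indicator (cball 0 (R + 1)) x * B"])
    show "AE x in lborel. (\<lambda>n. ?q n x) \<longlonglongrightarrow> g x \<bullet> b"
    proof (rule AE_I2)
      fix x
      have "((\<lambda>t. x + t *\<^sub>R b) has_derivative (\<lambda>t. t *\<^sub>R b)) (at 0)"
        by (auto intro!: derivative_eq_intros)
      moreover have "(h has_derivative (\<lambda>v. v \<bullet> g x)) (at (x + 0 *\<^sub>R b))"
        using g(1)[of x] by (simp add: gderiv_def)
      ultimately have "((\<lambda>t. h (x + t *\<^sub>R b)) has_derivative (\<lambda>t. (t *\<^sub>R b) \<bullet> g x)) (at 0)"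
        by (rule has_derivative_compose)
      moreover have "(\<lambda>t. (t *\<^sub>R b) \<bullet> g x) = (*) (g x \<bullet> b)"
        by (auto simp: inner_commute)
      ultimately have "DERIV (\<lambda>t. h (x + t *\<^sub>R b)) 0 :> g x \<bullet> b"
        by (simp add: has_field_derivative_def)
      then have lim: "((\<lambda>t. (h (x + t *\<^sub>R b) - h x) / t) \<longlongrightarrow> g x \<bullet> b) (at 0)"
        by (simp add: DERIV_def)
      have "filterlim e (at 0) sequentially"
        unfolding filterlim_at e_def using LIMSEQ_inverse_real_of_nat by (auto simp del: of_nat_Suc)
      from filterlim_compose[OF lim this] show "(\<lambda>n. ?q n x) \<longlonglongrightarrow> g x \<bullet> b" .
    qed
    show "AE x in lborel. norm (?q n x) \<le> indicator (cball 0 (R + 1)) x * B" for n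
    proof (rule AE_I2)
      fix x
      show "norm (?q n x) \<le> indicator (cball 0 (R + 1)) x * B"
      proof (cases "x \<in> cball 0 (R + 1)")
        case True
        have "\<bar>h (x + e n *\<^sub>R b) - h x\<bar> \<le> B * e n"
          using lip[of "x + e n *\<^sub>R b" x] e(1)[of n] b by simp
        with True e(1)[of n] show ?thesis by (simp add: field_simps)
      next
        case False
        then have "norm x > R + 1" by simp
        moreover have "norm x \<le> norm (x + e n *\<^sub>R b) + e n"
          using norm_triangle_ineq4[of "x + e n *\<^sub>R b" "e n *\<^sub>R b"] e(1)[of n] b by simp
        ultimately have "norm (x + e n *\<^sub>R b) > R" "norm x > R" using e(2)[of n] by linarith+
        then have "h (x + e n *\<^sub>R b) = 0" "h x = 0" using R K(2) by (meson not_le)+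
        with False show ?thesis by simp
      qed
    qed
    show "integrable lborel (\<lambda>x::'a. indicator (cball 0 (R + 1)) x * B :: real)"
      using borel_integrable_compact[of "cball 0 (R + 1) :: 'a set" "\<lambda>_. B"] by simp
  qed (use hm gm in measurable)
  moreover have "(LINT x|lborel. ?q n x) = 0" for n
  proof -
    have hi: "integrable lborel h" using compact_support_integrable[OF K(1) cont_h K(2)] .
    have hi2: "integrable lborel (\<lambda>x. h (e n *\<^sub>R b + x))"
      by (rule integrable_distr_eq[THEN iffD1, of "(+) (e n *\<^sub>R b)" lborel borel h])
         (use hi in \<open>auto simp: lborel_distr_plus\<close>)
    have "(LINT x|lborel. h x) = (LINT x|distr lborel borel ((+) (e n *\<^sub>R b)). h x)"
      by (simp add: lborel_distr_plus)
    also have "\<dots> = (LINT x|lborel. h (e n *\<^sub>R b + x))" by (subst integral_distr) auto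
    finally show ?thesis using hi hi2 by (simp add: add.commute[of _ "e n *\<^sub>R b"])
  qed
  ultimately have "(\<lambda>_. 0) \<longlonglongrightarrow> (LINT x|lborel. g x \<bullet> b)" by (simp only:)
  then show ?thesis by (simp add: LIMSEQ_const_iff)
qed

lemma locally_integrable_continuous:
  fixes f :: "'a::euclidean_space \<Rightarrow> 'b::euclidean_space"
  assumes "continuous_on UNIV f" shows "locally_integrable \<Omega> f"
  unfolding locally_integrable_def set_integrable_def
proof (intro allI impI)
  fix C :: "'a set" assume C: "compact C \<and> C \<subseteq> \<Omega>"
  then have i: "integrable lborel (\<lambda>x. indicator C x *\<^sub>R f x)"
    using borel_integrable_compact[of C f] continuous_on_subset[OF assms] by blast
  then show "integrable lebesgue (\<lambda>x. indicator C x *\<^sub>R f x)"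
    by (subst integrable_completion) auto
qed

lemma test_function_integrable:
  fixes f :: "'a::euclidean_space \<Rightarrow> 'b::euclidean_space"
  assumes \<Omega>: "open \<Omega>" and K: "compact K" "K \<subseteq> \<Omega>" and f: "continuous_on UNIV f" "\<And>x. x \<notin> K \<Longrightarrow> f x = 0"
  shows "integrable (lebesgue_on \<Omega>) f" and "(LINT x|lebesgue_on \<Omega>. f x) = (LINT x|lborel. f x)"
proof -
  have eq: "(\<lambda>x. indicator \<Omega> x *\<^sub>R f x) = f" using K(2) f(2) by (auto simp: indicator_def fun_eq_iff)
  have i: "integrable lborel f" by (rule compact_support_integrable[OF K(1) f])
  then have i': "integrable lebesgue f" by (subst integrable_completion) auto
  have o: "\<Omega> \<inter> space lebesgue \<in> sets lebesgue" using \<Omega> by auto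
  show "integrable (lebesgue_on \<Omega>) f" using i' by (simp add: integrable_restrict_space[OF o] eq)
  show "(LINT x|lebesgue_on \<Omega>. f x) = (LINT x|lborel. f x)"
    using i by (simp add: integral_restrict_space[OF o] eq integral_completion)
qed

text \<open>Every component of the gradient of the product \<phi> \<psi> integrates to zero; with
  the product rule this is the integration by parts.\<close>

lemma test_function_has_weak_grad:
  assumes \<Omega>: "open \<Omega>" and \<phi>: "\<phi> \<in> test_functions \<Omega>"
  shows "has_weak_grad \<Omega> \<phi> (grad \<phi>)"
  unfolding has_weak_grad_def
proof (intro conjI ballI)
  show "locally_integrable \<Omega> \<phi>" "locally_integrable \<Omega> (grad \<phi>)"
    by (intro locally_integrable_continuous test_function_C1[OF \<phi>])+
  fix \<psi> assume \<psi>: "\<psi> \<in> test_functions \<Omega>"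
  obtain K where K: "compact K" "K \<subseteq> \<Omega>" "\<And>x. x \<notin> K \<Longrightarrow> \<phi> x = 0" "\<And>x. x \<notin> K \<Longrightarrow> grad \<phi> x = 0"
    using test_function_support[OF \<phi>] by blast
  note C\<phi> = test_function_C1[OF \<phi>] and C\<psi> = test_function_C1[OF \<psi>]
  have c: "continuous_on UNIV (\<lambda>x. \<phi> x *\<^sub>R grad \<psi> x)" "continuous_on UNIV (\<lambda>x. \<psi> x *\<^sub>R grad \<phi> x)"
    using C\<phi> C\<psi> by (auto intro!: continuous_on_scaleR)
  have i1: "integrable (lebesgue_on \<Omega>) (\<lambda>x. \<phi> x *\<^sub>R grad \<psi> x)"
    by (rule test_function_integrable(1)[OF \<Omega> K(1,2) c(1)]) (use K in auto)
  have i2: "integrable (lebesgue_on \<Omega>) (\<lambda>x. \<psi> x *\<^sub>R grad \<phi> x)"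
    by (rule test_function_integrable(1)[OF \<Omega> K(1,2) c(2)]) (use K in auto)
  let ?g = "\<lambda>x. \<phi> x *\<^sub>R grad \<psi> x + \<psi> x *\<^sub>R grad \<phi> x"
  have "(LINT x|lebesgue_on \<Omega>. ?g x) = 0"
  proof (rule euclidean_eqI)
    fix b :: 'a assume b: "b \<in> Basis"
    have "(LINT x|lebesgue_on \<Omega>. ?g x) \<bullet> b = (LINT x|lebesgue_on \<Omega>. ?g x \<bullet> b)"
      using i1 i2 by (subst integral_inner_left) auto
    also have "\<dots> = (LINT x|lborel. ?g x \<bullet> b)"
      by (rule test_function_integrable(2)[OF \<Omega> K(1,2)]) (use K c in \<open>auto intro!: continuous_intros\<close>)
    also have "\<dots> = 0"
      by (rule integral_directional_derivative_zero[where h = "\<lambda>x. \<phi> x * \<psi> x", OF K(1)])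
         (use K b c C\<phi>(1) C\<psi>(1) in \<open>auto intro!: GDERIV_mult continuous_on_add simp: add.commute\<close>)
    finally show "(LINT x|lebesgue_on \<Omega>. ?g x) \<bullet> b = 0 \<bullet> b" by simp
  qed
  then show "(LINT x|lebesgue_on \<Omega>. \<phi> x *\<^sub>R grad \<psi> x) = - (LINT x|lebesgue_on \<Omega>. \<psi> x *\<^sub>R grad \<phi> x)"
    using i1 i2 by (simp add: eq_neg_iff_add_eq_0)
qed

subsection \<open>The integrand and its conjugate\<close>

text \<open>With \<open>k = \<kappa>(x)\<close>, the functions \<open>phr\<close> and \<open>psr\<close> are the real forms of \<open>\<phi>\<^sub>\<gamma>(x, \<cdot>)\<close> and of its
  conjugate, and \<open>young_opt\<close> is a point at which the supremum defining the conjugate is attained: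
  the slope of \<open>phr\<close> is \<open>\<alpha>\<close> up to the kink at \<open>t = k\<close> and \<open>\<alpha>(1 + \<gamma>) + \<alpha> \<gamma> log (t/k)\<close> beyond it.\<close>
definition phr :: "real \<Rightarrow> real \<Rightarrow> real \<Rightarrow> real \<Rightarrow> real" where
  "phr \<alpha> \<gamma> k t = \<alpha> * t * (1 + \<gamma> * log_plus (t / k))"

definition psr :: "real \<Rightarrow> real \<Rightarrow> real \<Rightarrow> real \<Rightarrow> real" where
  "psr \<alpha> \<gamma> k s = (if s \<le> \<alpha> then 0 else if s \<le> \<alpha> * (1 + \<gamma>) then k * (s - \<alpha>)
     else \<alpha> * \<gamma> * k * exp ((s - \<alpha> * (1 + \<gamma>)) / (\<alpha> * \<gamma>)))"

definition young_opt :: "real \<Rightarrow> real \<Rightarrow> real \<Rightarrow> real \<Rightarrow> real" where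
  "young_opt \<alpha> \<gamma> k s = (if s \<le> \<alpha> then 0
     else k * exp (max 0 ((s - \<alpha> * (1 + \<gamma>)) / (\<alpha> * \<gamma>))))"

lemma log_plus_nonneg: "log_plus r \<ge> 0"
  by (simp add: log_plus_def)

lemma log_plus_mono: "r \<le> s \<Longrightarrow> log_plus r \<le> log_plus s"
  by (auto simp: log_plus_def max_def)

lemma log_plus_le: "r \<ge> 0 \<Longrightarrow> log_plus r \<le> r"
  using ln_bound[of r] by (auto simp: log_plus_def max_def)

lemma log_plus_mult: "r \<ge> 0 \<Longrightarrow> s \<ge> 0 \<Longrightarrow> log_plus (r * s) \<le> log_plus r + log_plus s"
proof (cases "r > 0 \<and> s > 0")
  case True
  then show ?thesis by (simp add: log_plus_def ln_mult_pos)
qed (auto simp: log_plus_def)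

context
  fixes \<alpha> \<gamma> :: real
  assumes pos: "\<alpha> > 0" "\<gamma> > 0"
begin

lemma phr_mono: "0 \<le> s \<Longrightarrow> s \<le> t \<Longrightarrow> k > 0 \<Longrightarrow> phr \<alpha> \<gamma> k s \<le> phr \<alpha> \<gamma> k t"
  unfolding phr_def using pos
  by (intro mult_mono add_mono log_plus_mono divide_right_mono order.refl)
     (auto simp: log_plus_nonneg intro!: add_nonneg_nonneg mult_nonneg_nonneg)

lemma phr_lower: "t \<ge> 0 \<Longrightarrow> \<alpha> * t \<le> phr \<alpha> \<gamma> k t"
  unfolding phr_def using pos mult_left_mono[of 1 "1 + \<gamma> * log_plus (t / k)" "\<alpha> * t"]
  by (simp add: log_plus_nonneg)

lemma phr_nonneg: "t \<ge> 0 \<Longrightarrow> phr \<alpha> \<gamma> k t \<ge> 0"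
  using phr_lower[of t k] pos by (meson less_eq_real_def mult_nonneg_nonneg order_trans)

text \<open>The estimate log^+ r <= r is crude, but quadratic growth is what puts square integrable
  fields into Y.\<close>

lemma phr_upper:
  assumes "t \<ge> 0" "0 < c" "c \<le> k" shows "phr \<alpha> \<gamma> k t \<le> \<alpha> * t + \<alpha> * \<gamma> / c * t\<^sup>2"
proof -
  have "log_plus (t / k) \<le> t / c"
    using log_plus_le[of "t / k"] assms by (smt (verit) divide_nonneg_pos frac_le)
  then have "\<alpha> * t * (\<gamma> * log_plus (t / k)) \<le> \<alpha> * t * (\<gamma> * (t / c))"
    using pos assms by (intro mult_left_mono) auto
  then show ?thesis by (simp add: phr_def algebra_simps power2_eq_square)
qed

text \<open>The doubling property. It combines log^+ (r s) <= log^+ r + log^+ s with 1 + a + b <= (1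
  + a) (1 + b) for a, b >= 0.\<close>

lemma phr_mult:
  assumes "t \<ge> 0" "r \<ge> 0" "k > 0"
  shows "phr \<alpha> \<gamma> k (r * t) \<le> r * (1 + \<gamma> * log_plus r) * phr \<alpha> \<gamma> k t"
proof -
  let ?L = "log_plus (t / k)" and ?R = "log_plus r"
  have "log_plus (r * t / k) \<le> ?R + ?L"
    using log_plus_mult[of r "t / k"] assms by simp
  then have "1 + \<gamma> * log_plus (r * t / k) \<le> 1 + \<gamma> * (?R + ?L)" using pos by simp
  also have "\<dots> \<le> (1 + \<gamma> * ?R) * (1 + \<gamma> * ?L)"
    using pos by (simp add: algebra_simps log_plus_nonneg)
  finally have "\<alpha> * (r * t) * (1 + \<gamma> * log_plus (r * t / k)) \<le> \<alpha> * (r * t) * ((1 + \<gamma> * ?R) * (1 + \<gamma> * ?L))"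
    using pos assms by (intro mult_left_mono) auto
  then show ?thesis by (simp add: phr_def mult_ac)
qed

text \<open>Here log^+ r = 0. Later proofs use this in place of convexity.\<close>

lemma phr_mult_le_1:
  assumes "t \<ge> 0" "0 \<le> r" "r \<le> 1" "k > 0"
  shows "phr \<alpha> \<gamma> k (r * t) \<le> r * phr \<alpha> \<gamma> k t"
  using phr_mult[of t r k] assms by (simp add: log_plus_def max_def split: if_splits)

lemma young_opt_nonneg: "k > 0 \<Longrightarrow> young_opt \<alpha> \<gamma> k s \<ge> 0"
  by (simp add: young_opt_def)

text \<open>Where p is bounded the maximizer is bounded too, which is why truncating p yields
  admissible test fields.\<close>

lemma young_opt_bound:
  assumes "0 < k" "k \<le> K" "s \<le> S" "0 \<le> S"
  shows "young_opt \<alpha> \<gamma> k s \<le> K * exp (S / (\<alpha> * \<gamma>))"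
proof (cases "s \<le> \<alpha>")
  case False
  have "max 0 ((s - \<alpha> * (1 + \<gamma>)) / (\<alpha> * \<gamma>)) \<le> S / (\<alpha> * \<gamma>)"
  proof -
    have "(s - \<alpha> * (1 + \<gamma>)) / (\<alpha> * \<gamma>) \<le> S / (\<alpha> * \<gamma>)"
      using assms pos by (intro divide_right_mono) (auto simp: algebra_simps, smt (verit) mult_pos_pos)
    then show ?thesis using assms pos by simp
  qed
  then show ?thesis using False assms by (auto simp: young_opt_def intro!: mult_mono)
qed (use assms in \<open>simp add: young_opt_def\<close>)

lemma psr_nonneg: "k > 0 \<Longrightarrow> psr \<alpha> \<gamma> k s \<ge> 0"
  using pos by (auto simp: psr_def)

lemma psr_eq_young_opt:
  assumes "k > 0"
  shows "s * young_opt \<alpha> \<gamma> k s = phr \<alpha> \<gamma> k (young_opt \<alpha> \<gamma> k s) + psr \<alpha> \<gamma> k s"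
proof -
  consider "s \<le> \<alpha>" | "s > \<alpha>" "s \<le> \<alpha> * (1 + \<gamma>)" | "s > \<alpha>" "s > \<alpha> * (1 + \<gamma>)" by linarith
  then show ?thesis
  proof cases
    case 1
    then show ?thesis by (simp add: young_opt_def psr_def phr_def)
  next
    case 2
    then have "(s - \<alpha> * (1 + \<gamma>)) / (\<alpha> * \<gamma>) \<le> 0" using pos by (simp add: divide_nonpos_pos)
    with 2 have "young_opt \<alpha> \<gamma> k s = k" by (simp add: young_opt_def)
    with 2 assms show ?thesis by (simp add: psr_def phr_def log_plus_def algebra_simps)
  next
    case 3
    define z where "z = (s - \<alpha> * (1 + \<gamma>)) / (\<alpha> * \<gamma>)"
    have z: "z > 0" "s = \<alpha> * (1 + \<gamma>) + \<alpha> * \<gamma> * z" using 3 pos by (auto simp: z_def field_simps)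
    have y: "young_opt \<alpha> \<gamma> k s = k * exp z" using 3(1) z(1) by (simp add: young_opt_def flip: z_def)
    have p: "psr \<alpha> \<gamma> k s = \<alpha> * \<gamma> * k * exp z" using 3 by (simp add: psr_def flip: z_def)
    have l: "log_plus (k * exp z / k) = z" using assms z(1) by (simp add: log_plus_def)
    show ?thesis unfolding y p phr_def l using z(2) by (simp add: algebra_simps)
  qed
qed

text \<open>In the variable log (t / k) the exponential estimates reduce to 1 + x <= exp x, so the
  maximum over t is never located by differentiation.\<close>

lemma young_phr:
  assumes k: "k > 0" and t: "t \<ge> 0"
  shows "s * t \<le> phr \<alpha> \<gamma> k t + psr \<alpha> \<gamma> k s"
proof -
  have g: "(s - \<alpha>) * t - \<alpha> * \<gamma> * t * log_plus (t / k) \<le> psr \<alpha> \<gamma> k s"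
  proof -
    consider "s \<le> \<alpha>" | "s > \<alpha>" "s \<le> \<alpha> * (1 + \<gamma>)" | "s > \<alpha>" "s > \<alpha> * (1 + \<gamma>)" by linarith
    then show ?thesis
    proof cases
      case 1
      then have "(s - \<alpha>) * t \<le> 0" using t by (simp add: mult_nonpos_nonneg)
      moreover have "\<alpha> * \<gamma> * t * log_plus (t / k) \<ge> 0" using pos t by (simp add: log_plus_nonneg)
      ultimately show ?thesis using 1 by (simp add: psr_def)
    next
      case 2
      have p: "psr \<alpha> \<gamma> k s = k * (s - \<alpha>)" using 2 by (simp add: psr_def)
      show ?thesis
      proof (cases "t \<le> k")
        case True
        have "(s - \<alpha>) * t \<le> (s - \<alpha>) * k" using True 2 by (intro mult_left_mono) auto
        moreover have "\<alpha> * \<gamma> * t * log_plus (t / k) \<ge> 0" using pos t by (simp add: log_plus_nonneg)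
        ultimately show ?thesis unfolding p by (simp add: algebra_simps)
      next
        case False
        define y where "y = ln (t / k)"
        have y: "y > 0" "t = k * exp y" using False k t by (auto simp: y_def)
        have l: "log_plus (t / k) = y" using y k by (simp add: log_plus_def)
        \<comment> \<open>This is 1 + x <= exp x at x = - y, multiplied by exp y.\<close>
        have "exp y - 1 \<le> y * exp y"
          using exp_ge_add_one_self[of "- y"] by (simp add: exp_minus field_simps)
        then have "(s - \<alpha>) * (exp y - 1) \<le> (s - \<alpha>) * (y * exp y)"
          using 2 by (intro mult_left_mono) auto
        also have "\<dots> \<le> \<alpha> * \<gamma> * (y * exp y)"
          using 2 y by (intro mult_right_mono) (auto simp: algebra_simps)
        finally have "k * ((s - \<alpha>) * (exp y - 1)) \<le> k * (\<alpha> * \<gamma> * (y * exp y))"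
          using k by (intro mult_left_mono) auto
        then show ?thesis unfolding p l unfolding y(2) by (simp add: algebra_simps)
      qed
    next
      case 3
      define z where "z = (s - \<alpha> * (1 + \<gamma>)) / (\<alpha> * \<gamma>)"
      have z: "z > 0" "s = \<alpha> * (1 + \<gamma>) + \<alpha> * \<gamma> * z" using 3 pos by (auto simp: z_def field_simps)
      have p: "psr \<alpha> \<gamma> k s = \<alpha> * \<gamma> * k * exp z" using 3 by (simp add: psr_def flip: z_def)
      have sa: "s - \<alpha> = \<alpha> * \<gamma> * (1 + z)" using z(2) by (simp add: algebra_simps)
      \<comment> \<open>The maximum treats t <= k and t > k together: t <= k exp y holds in both
        cases.\<close>
      define y where "y = max 0 (ln (t / k))"
      have "t * (1 + z - y) \<le> k * exp z"
      proof (cases "1 + z - y \<ge> 0")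
        case True
        have "t \<le> k * exp y"
        proof (cases "t = 0")
          case False
          then have "t = k * exp (ln (t / k))" using k t by simp
          also have "\<dots> \<le> k * exp y" using k by (simp add: y_def)
          finally show ?thesis .
        qed (use k in simp)
        then have "t * (1 + z - y) \<le> k * exp y * (1 + z - y)" using True by (rule mult_right_mono)
        also have "\<dots> \<le> k * exp y * exp (z - y)"
          using exp_ge_add_one_self[of "z - y"] k by (intro mult_left_mono) (simp_all add: add_diff_eq)
        also have "\<dots> = k * exp z" by (simp add: exp_diff)
        finally show ?thesis .
      next
        case False
        then have "t * (1 + z - y) \<le> 0" using t by (simp add: mult_nonneg_nonpos)
        also have "0 \<le> k * exp z" using k by simp
        finally show ?thesis .
      qed
      then have "\<alpha> * \<gamma> * (t * (1 + z - y)) \<le> \<alpha> * \<gamma> * (k * exp z)" using pos by (intro mult_left_mono) auto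
      moreover have "t * log_plus (t / k) = t * y" using k t by (cases "t = 0") (auto simp: log_plus_def y_def)
      then have l: "\<alpha> * \<gamma> * t * log_plus (t / k) = \<alpha> * \<gamma> * (t * y)" by (simp add: mult.assoc)
      ultimately show ?thesis unfolding p sa l by (simp add: algebra_simps)
    qed
  qed
  then show ?thesis by (simp add: phr_def algebra_simps)
qed

text \<open>Young's inequality at t = c, which does not exceed the kink, so \<open>phr\<close> takes
  the value \<alpha> c there.\<close>

lemma psr_lower:
  assumes "0 < c" "c \<le> k" shows "c * (s - \<alpha>) \<le> psr \<alpha> \<gamma> k s"
  using young_phr[of k c s] assms by (simp add: phr_def log_plus_def algebra_simps split: if_splits)

lemma phi_star_eq_psr:
  assumes "\<kappa> x > 0"
  shows "phi_star \<alpha> \<gamma> \<kappa> x s = ereal (psr \<alpha> \<gamma> (\<kappa> x) s)"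
  unfolding phi_star_def
proof (rule antisym)
  show "(SUP t\<in>{0..}. ereal (s * t) - phi \<alpha> \<gamma> \<kappa> x t) \<le> ereal (psr \<alpha> \<gamma> (\<kappa> x) s)"
    using young_phr[OF assms] by (intro SUP_least) (simp add: phi_def phr_def diff_le_eq add.commute)
  have "ereal (psr \<alpha> \<gamma> (\<kappa> x) s) = ereal (s * young_opt \<alpha> \<gamma> (\<kappa> x) s) - phi \<alpha> \<gamma> \<kappa> x (young_opt \<alpha> \<gamma> (\<kappa> x) s)"
    using psr_eq_young_opt[OF assms, of s] by (simp add: phi_def phr_def)
  also have "\<dots> \<le> (SUP t\<in>{0..}. ereal (s * t) - phi \<alpha> \<gamma> \<kappa> x t)"
    using young_opt_nonneg[OF assms] by (intro SUP_upper) simp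
  finally show "ereal (psr \<alpha> \<gamma> (\<kappa> x) s) \<le> (SUP t\<in>{0..}. ereal (s * t) - phi \<alpha> \<gamma> \<kappa> x t)" .
qed

end

lemma phi_eq_phr: "phi \<alpha> \<gamma> \<kappa> x t = ereal (phr \<alpha> \<gamma> (\<kappa> x) t)"
  by (simp add: phi_def phr_def)

subsection \<open>Duality of the Musielak-Orlicz spaces\<close>

lemma log_plus_measurable[measurable]: "log_plus \<in> borel_measurable borel"
  unfolding log_plus_def by measurable

text \<open>The bounds on \<kappa> hold at every point here, so pointwise inequalities carry no
  exceptional set; the theorem reaches this setting by altering \<kappa> on a null set.\<close>

locale musielak_orlicz =
  fixes \<Omega> :: "'a::euclidean_space set" and \<alpha> \<gamma> km kp :: real and \<kappa> :: "'a \<Rightarrow> real"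
  assumes open_domain: "open \<Omega>" and bounded_domain: "bounded \<Omega>"
    and pos: "\<alpha> > 0" "\<gamma> > 0"
    and kappa_measurable[measurable]: "\<kappa> \<in> borel_measurable (lebesgue_on \<Omega>)"
    and km_pos: "km > 0" and kappa_bounds: "\<And>x. km \<le> \<kappa> x" "\<And>x. \<kappa> x \<le> kp"
begin

abbreviation "M \<equiv> lebesgue_on \<Omega>"
abbreviation "\<Phi> x t \<equiv> phr \<alpha> \<gamma> (\<kappa> x) t"
abbreviation "\<Psi> x s \<equiv> psr \<alpha> \<gamma> (\<kappa> x) s"
abbreviation "Y \<equiv> Y_space \<Omega> \<alpha> \<gamma> \<kappa>"
abbreviation "Z \<equiv> MO_space \<Omega> (phi_star \<alpha> \<gamma> \<kappa>)"
abbreviation "nrm \<equiv> luxemburg_norm \<Omega> (phi \<alpha> \<gamma> \<kappa>)"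

lemma kappa_pos: "\<kappa> x > 0"
  using km_pos kappa_bounds(1)[of x] by linarith

sublocale finite_measure M
  using open_domain bounded_domain by (intro finite_measure_lebesgue_on lmeasurable_open)

lemma modular_phi: "modular \<Omega> (phi \<alpha> \<gamma> \<kappa>) v = (\<integral>\<^sup>+x. ennreal (\<Phi> x (norm (v x))) \<partial>M)"
  by (simp add: modular_def phi_eq_phr ennreal.abs_eq)

lemma modular_phi_star: "modular \<Omega> (phi_star \<alpha> \<gamma> \<kappa>) p = (\<integral>\<^sup>+x. ennreal (\<Psi> x (norm (p x))) \<partial>M)"
  by (simp add: modular_def phi_star_eq_psr[where \<kappa> = \<kappa>, OF pos kappa_pos] ennreal.abs_eq)

lemma Phi_measurable[measurable (raw)]:
  assumes [measurable]: "g \<in> borel_measurable M"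
  shows "(\<lambda>x. \<Phi> x (g x)) \<in> borel_measurable M"
  unfolding phr_def by measurable

lemma Psi_measurable[measurable (raw)]:
  assumes [measurable]: "g \<in> borel_measurable M"
  shows "(\<lambda>x. \<Psi> x (g x)) \<in> borel_measurable M"
  unfolding psr_def by measurable

lemma Phi_nonneg: "t \<ge> 0 \<Longrightarrow> \<Phi> x t \<ge> 0"
  by (rule phr_nonneg[OF pos])

lemma Phi_zero: "\<Phi> x 0 = 0"
  by (simp add: phr_def)

lemma Psi_nonneg: "\<Psi> x s \<ge> 0"
  by (rule psr_nonneg[OF pos kappa_pos])

section \<open>Finite modulars and the vector space Y\<close>

lemma integrable_iff_modular_phi:
  assumes "v \<in> borel_measurable M"
  shows "modular \<Omega> (phi \<alpha> \<gamma> \<kappa>) v < \<infinity> \<longleftrightarrow> integrable M (\<lambda>x. \<Phi> x (norm (v x)))"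
  using assms by (simp add: modular_phi integrable_iff_bounded Phi_nonneg)

lemma modular_phi_eq_integral:
  assumes "integrable M (\<lambda>x. \<Phi> x (norm (v x)))"
  shows "modular \<Omega> (phi \<alpha> \<gamma> \<kappa>) v = ennreal (LINT x|M. \<Phi> x (norm (v x)))"
  using assms unfolding modular_phi by (intro nn_integral_eq_integral) (auto simp: Phi_nonneg)

lemma integrable_Phi_scale:
  assumes "v \<in> borel_measurable M" "integrable M (\<lambda>x. \<Phi> x (norm (v x)))"
  shows "integrable M (\<lambda>x. \<Phi> x (norm (c *\<^sub>R v x)))"
proof (rule Bochner_Integration.integrable_bound)
  let ?r = "\<bar>c\<bar> * (1 + \<gamma> * log_plus \<bar>c\<bar>)"
  show "integrable M (\<lambda>x. ?r * \<Phi> x (norm (v x)))" using assms by simp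
  show "AE x in M. norm (\<Phi> x (norm (c *\<^sub>R v x))) \<le> norm (?r * \<Phi> x (norm (v x)))"
  proof (rule AE_I2)
    fix x
    have "0 \<le> \<Phi> x (norm (c *\<^sub>R v x))" by (simp add: Phi_nonneg)
    moreover have "\<Phi> x (norm (c *\<^sub>R v x)) \<le> ?r * \<Phi> x (norm (v x))"
      using phr_mult[OF pos, of "norm (v x)" "\<bar>c\<bar>" "\<kappa> x"] kappa_pos by simp
    ultimately show "norm (\<Phi> x (norm (c *\<^sub>R v x))) \<le> norm (?r * \<Phi> x (norm (v x)))" by simp
  qed
qed (use assms in measurable)

text \<open>Doubling removes the scaling factor from the definition of the space: rescaling c v by 1
  / c keeps the modular finite. For \<open>phi_star\<close> the factor has to stay, as in
  \<open>Z_E\<close>.\<close>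

lemma Y_iff: "v \<in> Y \<longleftrightarrow> v \<in> borel_measurable M \<and> integrable M (\<lambda>x. \<Phi> x (norm (v x)))"
proof
  assume "v \<in> Y"
  then obtain c where v: "v \<in> borel_measurable M" and c: "c > 0" "modular \<Omega> (phi \<alpha> \<gamma> \<kappa>) (\<lambda>x. c *\<^sub>R v x) < \<infinity>"
    by (auto simp: MO_space_def)
  have "(\<lambda>x. c *\<^sub>R v x) \<in> borel_measurable M" using v by measurable
  from integrable_Phi_scale[OF this, of "1 / c"] integrable_iff_modular_phi[OF this] c v
  show "v \<in> borel_measurable M \<and> integrable M (\<lambda>x. \<Phi> x (norm (v x)))" by simp
next
  assume "v \<in> borel_measurable M \<and> integrable M (\<lambda>x. \<Phi> x (norm (v x)))"
  then show "v \<in> Y"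
    using integrable_iff_modular_phi[of v] by (auto simp: MO_space_def intro!: exI[of _ 1])
qed

lemma Y_measurable: "v \<in> Y \<Longrightarrow> v \<in> borel_measurable M"
  by (simp add: Y_iff)

lemma Y_integrable: "v \<in> Y \<Longrightarrow> integrable M (\<lambda>x. \<Phi> x (norm (c *\<^sub>R v x)))"
  using integrable_Phi_scale[of v c] by (simp only: Y_iff)

lemma Y_scale: "v \<in> Y \<Longrightarrow> (\<lambda>x. c *\<^sub>R v x) \<in> Y"
  using Y_integrable[of v c] Y_measurable[of v] borel_measurable_scaleR[of "\<lambda>_. c" M v]
  by (simp only: Y_iff borel_measurable_const simp_thms)

lemma Y_dominated:
  assumes "w \<in> borel_measurable M" "v \<in> Y" "\<And>x. norm (w x) \<le> norm (v x)"
  shows "w \<in> Y"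
proof -
  have "integrable M (\<lambda>x. \<Phi> x (norm (w x)))"
  proof (rule Bochner_Integration.integrable_bound)
    show "integrable M (\<lambda>x. \<Phi> x (norm (v x)))" using assms(2) by (simp add: Y_iff)
    show "AE x in M. norm (\<Phi> x (norm (w x))) \<le> norm (\<Phi> x (norm (v x)))"
      using phr_mono[OF pos _ assms(3) kappa_pos] by (intro AE_I2) (simp add: Phi_nonneg)
  qed (use assms(1) in measurable)
  with assms(1) show ?thesis by (simp add: Y_iff)
qed

lemma Y_add:
  assumes "v \<in> Y" "w \<in> Y" shows "(\<lambda>x. v x + w x) \<in> Y"
proof -
  have [measurable]: "v \<in> borel_measurable M" "w \<in> borel_measurable M" using assms by (auto simp: Y_iff)
  have "integrable M (\<lambda>x. \<Phi> x (norm (v x + w x)))"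
  proof (rule Bochner_Integration.integrable_bound)
    \<comment> \<open>The norm of v + w is at most twice the larger of the two norms, so
      monotonicity and doubling do the work of convexity.\<close>
    show "integrable M (\<lambda>x. \<Phi> x (norm (2 *\<^sub>R v x)) + \<Phi> x (norm (2 *\<^sub>R w x)))"
      using Y_integrable assms by (intro Bochner_Integration.integrable_add)
    show "AE x in M. norm (\<Phi> x (norm (v x + w x))) \<le> norm (\<Phi> x (norm (2 *\<^sub>R v x)) + \<Phi> x (norm (2 *\<^sub>R w x)))"
    proof (rule AE_I2)
      fix x
      have n: "\<Phi> x (norm (2 *\<^sub>R v x)) \<ge> 0" "\<Phi> x (norm (2 *\<^sub>R w x)) \<ge> 0" "\<Phi> x (norm (v x + w x)) \<ge> 0"
        by (auto simp: Phi_nonneg)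
      have "norm (v x + w x) \<le> norm (2 *\<^sub>R v x) \<or> norm (v x + w x) \<le> norm (2 *\<^sub>R w x)"
        using norm_triangle_ineq[of "v x" "w x"] by auto
      then have "\<Phi> x (norm (v x + w x)) \<le> \<Phi> x (norm (2 *\<^sub>R v x)) \<or> \<Phi> x (norm (v x + w x)) \<le> \<Phi> x (norm (2 *\<^sub>R w x))"
        using phr_mono[OF pos _ _ kappa_pos] norm_ge_zero by blast
      with n show "norm (\<Phi> x (norm (v x + w x))) \<le> norm (\<Phi> x (norm (2 *\<^sub>R v x)) + \<Phi> x (norm (2 *\<^sub>R w x)))"
        by auto
    qed
  qed measurable
  then show ?thesis by (simp add: Y_iff)
qed

text \<open>The bound on the modular supplies the quadratic hypothesis of the Riesz theorem in
  \<open>dual_space_representation\<close>.\<close>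

lemma sq_integrable_in_Y:
  assumes v: "sq_integrable M v"
  shows "v \<in> Y" and "(LINT x|M. \<Phi> x (norm (v x))) \<le> \<alpha> * measure M \<Omega> + (\<alpha> + \<alpha> * \<gamma> / km) * sq_int M v"
proof -
  have [measurable]: "v \<in> borel_measurable M" using v by (simp add: sq_integrable_def)
  let ?b = "\<lambda>x. \<alpha> + (\<alpha> + \<alpha> * \<gamma> / km) * (norm (v x))\<^sup>2"
  have bi: "integrable M ?b" using v by (auto simp: sq_integrable_def)
  have le: "\<Phi> x (norm (v x)) \<le> ?b x" for x
  proof -
    have "norm (v x) \<le> 1 + (norm (v x))\<^sup>2" using sum_squares_bound[of "norm (v x)" 1] by simp
        (smt (verit) norm_ge_zero)
    then have "\<alpha> * norm (v x) \<le> \<alpha> * (1 + (norm (v x))\<^sup>2)" using pos by (intro mult_left_mono) auto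
    then show ?thesis
      using phr_upper[OF pos, of "norm (v x)" km "\<kappa> x"] km_pos kappa_bounds by (simp add: algebra_simps)
  qed
  have i: "integrable M (\<lambda>x. \<Phi> x (norm (v x)))"
  proof (rule Bochner_Integration.integrable_bound[OF bi])
    show "AE x in M. norm (\<Phi> x (norm (v x))) \<le> norm (?b x)"
    proof (rule AE_I2)
      fix x
      have "0 \<le> \<Phi> x (norm (v x))" by (simp add: Phi_nonneg)
      with le[of x] show "norm (\<Phi> x (norm (v x))) \<le> norm (?b x)" by simp
    qed
  qed measurable
  then show "v \<in> Y" by (simp add: Y_iff)
  have "(LINT x|M. \<Phi> x (norm (v x))) \<le> (LINT x|M. ?b x)" using i bi le by (intro integral_mono)
  also have "\<dots> = \<alpha> * measure M \<Omega> + (\<alpha> + \<alpha> * \<gamma> / km) * sq_int M v"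
    using v by (simp add: sq_integrable_def sq_int_def)
  finally show "(LINT x|M. \<Phi> x (norm (v x))) \<le> \<alpha> * measure M \<Omega> + (\<alpha> + \<alpha> * \<gamma> / km) * sq_int M v" .
qed

lemma bounded_sq_integrable:
  assumes [measurable]: "v \<in> borel_measurable M" and B: "\<And>x. norm (v x) \<le> B"
  shows "sq_integrable M v"
  unfolding sq_integrable_def
proof (intro conjI integrable_const_bound[where B = "B\<^sup>2"])
  show "AE x in M. norm ((norm (v x))\<^sup>2) \<le> B\<^sup>2" using B by (intro AE_I2) (simp add: power_mono)
qed measurable

section \<open>The Luxemburg seminorm on Y\<close>

lemma nrm_le:
  assumes "l > 0" "modular \<Omega> (phi \<alpha> \<gamma> \<kappa>) (\<lambda>x. v x /\<^sub>R l) \<le> 1"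
  shows "nrm v \<le> l"
  unfolding luxemburg_norm_def using assms by (intro cInf_lower bdd_belowI[of _ 0]) auto

text \<open>Dividing v by l >= 1 shrinks the modular at least by the factor l. In particular the set
  in \<open>luxemburg_norm\<close> is nonempty for v in Y, so its real \<open>Inf\<close> is a
  genuine infimum.\<close>

lemma modular_scaled_le_1:
  assumes v: "v \<in> Y" and l: "l \<ge> 1" "l \<ge> (LINT x|M. \<Phi> x (norm (v x)))"
  shows "modular \<Omega> (phi \<alpha> \<gamma> \<kappa>) (\<lambda>x. v x /\<^sub>R l) \<le> 1"
proof -
  have i: "integrable M (\<lambda>x. \<Phi> x (norm (v x)))" and i': "integrable M (\<lambda>x. \<Phi> x (norm (v x /\<^sub>R l)))"
    using v Y_integrable[OF v, of "inverse l"] by (auto simp: Y_iff)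
  have "(LINT x|M. \<Phi> x (norm (v x /\<^sub>R l))) \<le> (LINT x|M. inverse l * \<Phi> x (norm (v x)))"
  proof (rule integral_mono[OF i'])
    show "\<Phi> x (norm (v x /\<^sub>R l)) \<le> inverse l * \<Phi> x (norm (v x))" for x
      using phr_mult_le_1[OF pos, of "norm (v x)" "inverse l" "\<kappa> x"] kappa_pos l(1)
      by (simp add: inverse_le_1_iff)
  qed (use i in simp)
  also have "\<dots> = inverse l * (LINT x|M. \<Phi> x (norm (v x)))" by simp
  also have "\<dots> \<le> inverse l * l" using l by (intro mult_left_mono) auto
  also have "\<dots> = 1" using l by simp
  finally show ?thesis by (simp add: modular_phi_eq_integral[OF i'] ennreal_le_1)
qed

lemma nrm_le_modular:
  assumes v: "v \<in> Y" shows "nrm v \<le> 1 + (LINT x|M. \<Phi> x (norm (v x)))"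
proof -
  have "(LINT x|M. \<Phi> x (norm (v x))) \<ge> 0" by (simp add: Phi_nonneg)
  then show ?thesis using modular_scaled_le_1[OF v] by (intro nrm_le) auto
qed

lemma le_nrmI:
  assumes v: "v \<in> Y" and a: "\<And>l. l > 0 \<Longrightarrow> modular \<Omega> (phi \<alpha> \<gamma> \<kappa>) (\<lambda>x. v x /\<^sub>R l) \<le> 1 \<Longrightarrow> a \<le> l"
  shows "a \<le> nrm v"
proof -
  have "max 1 (LINT x|M. \<Phi> x (norm (v x))) \<in> {l. l > 0 \<and> modular \<Omega> (phi \<alpha> \<gamma> \<kappa>) (\<lambda>x. v x /\<^sub>R l) \<le> 1}"
    using modular_scaled_le_1[OF v] by auto
  then show ?thesis unfolding luxemburg_norm_def using a by (intro cInf_greatest) auto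
qed

section \<open>The conjugate space Z and its pairing with Y\<close>

lemma Z_E:
  assumes "p \<in> Z"
  obtains c where "p \<in> borel_measurable M" "c > 0" "integrable M (\<lambda>x. \<Psi> x (norm (c *\<^sub>R p x)))"
proof -
  obtain c where p: "p \<in> borel_measurable M" "c > 0" "modular \<Omega> (phi_star \<alpha> \<gamma> \<kappa>) (\<lambda>x. c *\<^sub>R p x) < \<infinity>"
    using assms by (auto simp: MO_space_def)
  then have "integrable M (\<lambda>x. \<Psi> x (norm (c *\<^sub>R p x)))"
    by (intro integrableI_bounded) (auto simp: modular_phi_star Psi_nonneg)
  with p that show thesis by simp
qed

lemma Z_measurable: "p \<in> Z \<Longrightarrow> p \<in> borel_measurable M"
  by (simp add: MO_space_def)

lemma young_inner: "p \<bullet> v \<le> \<Phi> x (norm v) + \<Psi> x (norm p)"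
proof -
  have "p \<bullet> v \<le> norm p * norm v" using Cauchy_Schwarz_ineq2[of p v] by linarith
  also have "\<dots> \<le> \<Phi> x (norm v) + \<Psi> x (norm p)" by (rule young_phr[OF pos kappa_pos norm_ge_zero])
  finally show ?thesis .
qed

lemma young_inner_abs: "\<bar>p \<bullet> v\<bar> \<le> \<Phi> x (norm v) + \<Psi> x (norm p)"
  using young_inner[of p v x] young_inner[of "- p" v x] by simp

lemma pairing_integrable:
  assumes "p \<in> Z" "v \<in> Y" shows "integrable M (\<lambda>x. p x \<bullet> v x)"
proof -
  obtain c where p: "p \<in> borel_measurable M" and c: "c > 0" "integrable M (\<lambda>x. \<Psi> x (norm (c *\<^sub>R p x)))"
    using Z_E[OF assms(1)] by blast
  have v: "v \<in> borel_measurable M" "integrable M (\<lambda>x. \<Phi> x (norm (v x)))" using assms(2) by (auto simp: Y_iff)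
  have "integrable M (\<lambda>x. (c *\<^sub>R p x) \<bullet> v x)"
  proof (rule Bochner_Integration.integrable_bound)
    show "integrable M (\<lambda>x. \<Phi> x (norm (v x)) + \<Psi> x (norm (c *\<^sub>R p x)))" using c v by auto
    show "AE x in M. norm ((c *\<^sub>R p x) \<bullet> v x) \<le> norm (\<Phi> x (norm (v x)) + \<Psi> x (norm (c *\<^sub>R p x)))"
    proof (rule AE_I2)
      fix x
      show "norm ((c *\<^sub>R p x) \<bullet> v x) \<le> norm (\<Phi> x (norm (v x)) + \<Psi> x (norm (c *\<^sub>R p x)))"
        using young_inner_abs[of "c *\<^sub>R p x" "v x" x] unfolding real_norm_def by linarith
    qed
  qed (use p v in measurable)
  with c show ?thesis by simp
qed

text \<open>\<open>has_distr_div\<close> demands local integrability; for fields of Z it comes from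
  the linear lower bound \<open>psr_lower\<close>.\<close>

lemma Z_integrable:
  assumes "p \<in> Z" shows "integrable M p"
proof -
  obtain c where [measurable]: "p \<in> borel_measurable M" and c: "c > 0" "integrable M (\<lambda>x. \<Psi> x (norm (c *\<^sub>R p x)))"
    using Z_E[OF assms] by blast
  show ?thesis
  proof (rule Bochner_Integration.integrable_bound)
    show "integrable M (\<lambda>x. (\<Psi> x (norm (c *\<^sub>R p x)) / km + \<alpha>) / c)" using c by auto
    show "AE x in M. norm (p x) \<le> norm ((\<Psi> x (norm (c *\<^sub>R p x)) / km + \<alpha>) / c)"
    proof (rule AE_I2)
      fix x
      have "km * (norm (c *\<^sub>R p x) - \<alpha>) \<le> \<Psi> x (norm (c *\<^sub>R p x))"
        by (rule psr_lower[OF pos km_pos kappa_bounds(1)])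
      then have "norm (p x) \<le> (\<Psi> x (norm (c *\<^sub>R p x)) / km + \<alpha>) / c"
        using c km_pos by (simp add: field_simps)
      then show "norm (p x) \<le> norm ((\<Psi> x (norm (c *\<^sub>R p x)) / km + \<alpha>) / c)"
        unfolding real_norm_def by linarith
    qed
  qed measurable
qed

lemma pairing_in_dual_space:
  assumes p: "p \<in> Z" shows "pairing \<Omega> p \<in> dual_space Y nrm"
proof -
  obtain c where pm: "p \<in> borel_measurable M" and c: "c > 0" "integrable M (\<lambda>x. \<Psi> x (norm (c *\<^sub>R p x)))"
    using Z_E[OF p] by blast
  \<comment> \<open>Young's inequality for c p and v / l, with the modular of v / l at most 1,
    bounds the pairing times c / l by A c.\<close>
  define A where "A = (1 + (LINT x|M. \<Psi> x (norm (c *\<^sub>R p x)))) / c"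
  have "(LINT x|M. \<Psi> x (norm (c *\<^sub>R p x))) \<ge> 0" by (simp add: Psi_nonneg)
  then have A: "A > 0" using c by (simp add: A_def)
  have "\<bar>pairing \<Omega> p v\<bar> \<le> A * nrm v" if v: "v \<in> Y" for v
  proof -
    have "\<bar>pairing \<Omega> p v\<bar> / A \<le> nrm v"
    proof (rule le_nrmI[OF v])
      fix l :: real assume l: "l > 0" "modular \<Omega> (phi \<alpha> \<gamma> \<kappa>) (\<lambda>x. v x /\<^sub>R l) \<le> 1"
      have vl: "(\<lambda>x. v x /\<^sub>R l) \<in> Y" by (rule Y_scale[OF v])
      then have i: "integrable M (\<lambda>x. \<Phi> x (norm (v x /\<^sub>R l)))" by (simp only: Y_iff)
      have le1: "(LINT x|M. \<Phi> x (norm (v x /\<^sub>R l))) \<le> 1"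
        using l(2) unfolding modular_phi_eq_integral[OF i] by (simp add: ennreal_le_1)
      have "\<bar>pairing \<Omega> p v\<bar> * (c / l) = \<bar>LINT x|M. (c *\<^sub>R p x) \<bullet> (v x /\<^sub>R l)\<bar>"
        using c l by (simp add: pairing_def abs_mult field_simps)
      also have "\<dots> \<le> (LINT x|M. \<bar>(c *\<^sub>R p x) \<bullet> (v x /\<^sub>R l)\<bar>)" by (rule integral_abs_bound)
      also have "\<dots> \<le> (LINT x|M. \<Phi> x (norm (v x /\<^sub>R l)) + \<Psi> x (norm (c *\<^sub>R p x)))"
      proof (rule integral_mono)
        show "integrable M (\<lambda>x. \<bar>(c *\<^sub>R p x) \<bullet> (v x /\<^sub>R l)\<bar>)"
          using pairing_integrable[OF p vl] unfolding inner_scaleR_left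
          by (intro integrable_abs integrable_mult_right)
        show "\<bar>(c *\<^sub>R p x) \<bullet> (v x /\<^sub>R l)\<bar> \<le> \<Phi> x (norm (v x /\<^sub>R l)) + \<Psi> x (norm (c *\<^sub>R p x))" for x
          by (rule young_inner_abs)
      qed (use i c in auto)
      also have "\<dots> \<le> A * c" using i c le1 by (simp add: A_def)
      finally show "\<bar>pairing \<Omega> p v\<bar> / A \<le> l" using A c l by (simp add: field_simps)
    qed
    with A show ?thesis by (simp add: field_simps)
  qed
  moreover have "pairing \<Omega> p (\<lambda>x. v x + w x) = pairing \<Omega> p v + pairing \<Omega> p w" if "v \<in> Y" "w \<in> Y" for v w
    using pairing_integrable[OF p] that by (simp add: pairing_def inner_add_right)
  moreover have "pairing \<Omega> p (\<lambda>x. r *\<^sub>R v x) = r * pairing \<Omega> p v" for r v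
    by (simp add: pairing_def)
  ultimately show ?thesis unfolding dual_space_def by blast
qed

section \<open>The conjugate of G\<close>

text \<open>The direction sgn (p x) turns the inner product into a product of norms, so equality in
  the scalar Young inequality carries over to fields. Where norm (p x) > n the field w is 0 and both
  sides vanish.\<close>

lemma young_equality_truncated:
  fixes p :: "'a \<Rightarrow> 'a"
  assumes [measurable]: "p \<in> borel_measurable M"
  obtains w where "w \<in> borel_measurable M" "\<And>x. norm (w x) \<le> kp * exp (real n / (\<alpha> * \<gamma>))"
    "\<And>x. p x \<bullet> w x = \<Phi> x (norm (w x)) + indicator {x. norm (p x) \<le> real n} x * \<Psi> x (norm (p x))"
proof
  let ?I = "\<lambda>x. indicator {x. norm (p x) \<le> real n} x :: real"
  let ?o = "\<lambda>x. young_opt \<alpha> \<gamma> (\<kappa> x) (norm (p x))"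
  let ?w = "\<lambda>x. (?I x * ?o x) *\<^sub>R sgn (p x)"
  have [measurable]: "?o \<in> borel_measurable M" unfolding young_opt_def by measurable
  have "(\<lambda>x. sgn (p x)) \<in> borel_measurable M" 
    unfolding sgn_div_norm by measurable
  moreover have "?I \<in> borel_measurable M" by measurable
  ultimately show "?w \<in> borel_measurable M"
    by (intro borel_measurable_scaleR borel_measurable_times) measurable
  have o: "?o x \<ge> 0" for x by (rule young_opt_nonneg[OF pos kappa_pos])
  have o0: "?o x = 0" if "p x = 0" for x using that pos by (simp add: young_opt_def)
  have nw: "norm (?w x) = ?I x * ?o x" for x
    using o[of x] o0[of x] by (auto simp: norm_sgn indicator_def)
  have kp: "kp > 0" using kappa_pos kappa_bounds(2) by (meson less_le_trans)
  show "norm (?w x) \<le> kp * exp (real n / (\<alpha> * \<gamma>))" for x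
    unfolding nw using young_opt_bound[OF pos kappa_pos kappa_bounds(2), of "norm (p x)" "real n"] kp
    by (auto simp: indicator_def)
  show "p x \<bullet> ?w x = \<Phi> x (norm (?w x)) + ?I x * \<Psi> x (norm (p x))" for x
  proof -
    have "p x \<bullet> sgn (p x) = norm (p x)"
      by (cases "p x = 0")
         (simp_all add: sgn_div_norm power2_norm_eq_inner[symmetric] power2_eq_square)
    then have "p x \<bullet> ?w x = ?I x * (norm (p x) * ?o x)" by simp
    then show ?thesis
      unfolding nw using psr_eq_young_opt[OF pos kappa_pos, of "norm (p x)" x]
      by (auto simp: indicator_def phr_def)
  qed
qed

text \<open>Monotone convergence in \<open>ennreal\<close>, so that an infinite modular is covered
  as well.\<close>

lemma nn_integral_truncated_Psi:
  assumes [measurable]: "p \<in> borel_measurable M"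
  shows "modular \<Omega> (phi_star \<alpha> \<gamma> \<kappa>) p =
    (SUP n. \<integral>\<^sup>+x. ennreal (indicator {x. norm (p x) \<le> real n} x * \<Psi> x (norm (p x))) \<partial>M)"
proof -
  have "modular \<Omega> (phi_star \<alpha> \<gamma> \<kappa>) p =
    (\<integral>\<^sup>+x. (SUP n. ennreal (indicator {x. norm (p x) \<le> real n} x * \<Psi> x (norm (p x)))) \<partial>M)"
    unfolding modular_phi_star
  proof (intro nn_integral_cong antisym)
    fix x
    obtain n :: nat where "norm (p x) \<le> real n" using real_arch_simple by blast
    then show "ennreal (\<Psi> x (norm (p x))) \<le> (SUP n. ennreal (indicator {x. norm (p x) \<le> real n} x * \<Psi> x (norm (p x))))"
      by (intro SUP_upper2[of n]) auto
    show "(SUP n. ennreal (indicator {x. norm (p x) \<le> real n} x * \<Psi> x (norm (p x)))) \<le> ennreal (\<Psi> x (norm (p x)))"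
      by (intro SUP_least ennreal_leI) (auto simp: indicator_def Psi_nonneg)
  qed
  also have "\<dots> = (SUP n. \<integral>\<^sup>+x. ennreal (indicator {x. norm (p x) \<le> real n} x * \<Psi> x (norm (p x))) \<partial>M)"
    by (intro nn_integral_monotone_convergence_SUP)
       (auto simp: incseq_def le_fun_def indicator_def Psi_nonneg intro!: ennreal_leI)
  finally show ?thesis .
qed

lemma G_fun_eq:
  assumes "v \<in> Y" shows "G_fun \<Omega> \<alpha> \<gamma> \<kappa> v = ereal (LINT x|M. \<Phi> x (norm (v x)))"
  using assms by (simp add: G_fun_def modular_phi_eq_integral Y_iff enn2ereal_ennreal Phi_nonneg)

lemma conjugate_G:
  assumes p: "p \<in> Z"
  shows "fenchel_conj Y (G_fun \<Omega> \<alpha> \<gamma> \<kappa>) (pairing \<Omega> p) = enn2ereal (modular \<Omega> (phi_star \<alpha> \<gamma> \<kappa>) p)"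
proof (rule antisym)
  let ?Q = "modular \<Omega> (phi_star \<alpha> \<gamma> \<kappa>) p"
  let ?C = "fenchel_conj Y (G_fun \<Omega> \<alpha> \<gamma> \<kappa>) (pairing \<Omega> p)"
  have pm [measurable]: "p \<in> borel_measurable M" using p by (rule Z_measurable)
  show "?C \<le> enn2ereal ?Q"
    unfolding fenchel_conj_def
  proof (rule SUP_least)
    fix v assume v: "v \<in> Y"
    show "ereal (pairing \<Omega> p v) - G_fun \<Omega> \<alpha> \<gamma> \<kappa> v \<le> enn2ereal ?Q"
    \<comment> \<open>An infinite modular makes the bound trivial; otherwise Young's inequality can
      be integrated.\<close>
    proof (cases "?Q = \<infinity>")
      case False
      then have i: "integrable M (\<lambda>x. \<Psi> x (norm (p x)))"
        by (intro integrableI_bounded) (auto simp: modular_phi_star Psi_nonneg less_top)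
      have Q: "?Q = ennreal (LINT x|M. \<Psi> x (norm (p x)))"
        unfolding modular_phi_star using i by (intro nn_integral_eq_integral) (auto simp: Psi_nonneg)
      have iv: "integrable M (\<lambda>x. \<Phi> x (norm (v x)))" using v by (simp add: Y_iff)
      have "pairing \<Omega> p v \<le> (LINT x|M. \<Phi> x (norm (v x)) + \<Psi> x (norm (p x)))"
        unfolding pairing_def using i iv pairing_integrable[OF p v]
        by (intro integral_mono young_inner) auto
      then show ?thesis
        using i iv by (simp add: Q G_fun_eq[OF v] enn2ereal_ennreal Psi_nonneg)
    qed simp
  qed
  have C: "ereal (LINT x|M. indicator {x. norm (p x) \<le> real n} x * \<Psi> x (norm (p x))) \<le> ?C"
    and I: "integrable M (\<lambda>x. indicator {x. norm (p x) \<le> real n} x * \<Psi> x (norm (p x)))" for n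
  proof -
    let ?J = "\<lambda>x. indicator {x. norm (p x) \<le> real n} x * \<Psi> x (norm (p x))"
    obtain w where w: "w \<in> borel_measurable M" "\<And>x. norm (w x) \<le> kp * exp (real n / (\<alpha> * \<gamma>))"
      "\<And>x. p x \<bullet> w x = \<Phi> x (norm (w x)) + ?J x"
      using young_equality_truncated[OF pm] by blast
    have wY: "w \<in> Y" using sq_integrable_in_Y(1)[OF bounded_sq_integrable[OF w(1,2)]] .
    then have iw: "integrable M (\<lambda>x. \<Phi> x (norm (w x)))" by (simp add: Y_iff)
    have J: "?J = (\<lambda>x. p x \<bullet> w x - \<Phi> x (norm (w x)))" using w(3) by auto
    show "integrable M ?J" unfolding J using pairing_integrable[OF p wY] iw by auto
    have "ereal (LINT x|M. ?J x) = ereal (pairing \<Omega> p w) - G_fun \<Omega> \<alpha> \<gamma> \<kappa> w"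
      unfolding J G_fun_eq[OF wY] pairing_def using pairing_integrable[OF p wY] iw by simp
    also have "\<dots> \<le> ?C" unfolding fenchel_conj_def by (rule SUP_upper[OF wY])
    finally show "ereal (LINT x|M. ?J x) \<le> ?C" .
  qed
  \<comment> \<open>The case n = 0 shows that the conjugate is nonnegative; otherwise
    \<open>e2ennreal\<close> would cut it off at 0.\<close>
  have "?C \<ge> ereal (LINT x|M. indicator {x. norm (p x) \<le> real 0} x * \<Psi> x (norm (p x)))" by (rule C)
  moreover have "(LINT x|M. indicator {x. norm (p x) \<le> real 0} x * \<Psi> x (norm (p x))) \<ge> 0"
    by (simp add: Psi_nonneg)
  ultimately have C0: "?C \<ge> 0" by (meson ereal_less_eq(5) order_trans)
  have "?Q \<le> e2ennreal ?C"
    unfolding nn_integral_truncated_Psi[OF pm]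
  proof (rule SUP_least)
    fix n
    have "(\<integral>\<^sup>+x. ennreal (indicator {x. norm (p x) \<le> real n} x * \<Psi> x (norm (p x))) \<partial>M) =
        ennreal (LINT x|M. indicator {x. norm (p x) \<le> real n} x * \<Psi> x (norm (p x)))"
      using I[of n] by (intro nn_integral_eq_integral) (auto simp: Psi_nonneg)
    also have "\<dots> = e2ennreal (ereal (LINT x|M. indicator {x. norm (p x) \<le> real n} x * \<Psi> x (norm (p x))))"
      by simp
    also have "\<dots> \<le> e2ennreal ?C" by (intro e2ennreal_mono C)
    finally show "(\<integral>\<^sup>+x. ennreal (indicator {x. norm (p x) \<le> real n} x * \<Psi> x (norm (p x))) \<partial>M) \<le> e2ennreal ?C" .
  qed
  then have "enn2ereal ?Q \<le> enn2ereal (e2ennreal ?C)" by (simp add: less_eq_ennreal.rep_eq)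
  also have "\<dots> = ?C" using C0 by (simp add: enn2ereal_e2ennreal)
  finally show "enn2ereal ?Q \<le> ?C" .
qed

text \<open>A modular at most 1 at scale e gives norm at most e. By doubling v / e has finite
  modular at every scale e, which dominates the tails and lets their modulars tend to 0.\<close>

lemma nrm_tail_tendsto:
  assumes v: "v \<in> Y"
  shows "(\<lambda>n. nrm (\<lambda>x. indicator {x. norm (v x) > real n} x *\<^sub>R v x)) \<longlonglongrightarrow> 0"
proof (rule LIMSEQ_I)
  fix r :: real assume r: "r > 0"
  define e where "e = r / 2"
  have e: "e > 0" "e < r" using r by (auto simp: e_def)
  let ?t = "\<lambda>n x. indicator {x. norm (v x) > real n} x *\<^sub>R v x"
  have [measurable]: "v \<in> borel_measurable M" using v by (rule Y_measurable)
  have iv: "integrable M (\<lambda>x. \<Phi> x (norm (v x /\<^sub>R e)))" by (rule Y_integrable[OF v])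
  have tY: "?t n \<in> Y" for n by (rule Y_dominated[OF _ v]) (auto simp: indicator_def)
  have it: "integrable M (\<lambda>x. \<Phi> x (norm (?t n x /\<^sub>R e)))" for n
    by (rule Y_integrable[OF tY])
  have "(\<lambda>n. LINT x|M. \<Phi> x (norm (?t n x /\<^sub>R e))) \<longlonglongrightarrow> (LINT x|M. 0)"
  proof (rule integral_dominated_convergence[OF _ _ iv])
    show "AE x in M. (\<lambda>n. \<Phi> x (norm (?t n x /\<^sub>R e))) \<longlonglongrightarrow> 0"
    proof (rule AE_I2)
      fix x
      obtain N :: nat where "norm (v x) \<le> real N" using real_arch_simple by blast
      then show "(\<lambda>n. \<Phi> x (norm (?t n x /\<^sub>R e))) \<longlonglongrightarrow> 0"
        by (intro tendsto_eventually eventually_sequentiallyI[of N]) (auto simp: indicator_def Phi_zero)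
    qed
    show "AE x in M. norm (\<Phi> x (norm (?t n x /\<^sub>R e))) \<le> \<Phi> x (norm (v x /\<^sub>R e))" for n
    proof (rule AE_I2)
      fix x
      have nn: "\<Phi> x (norm (v x /\<^sub>R e)) \<ge> 0" by (rule Phi_nonneg) (rule norm_ge_zero)
      show "norm (\<Phi> x (norm (?t n x /\<^sub>R e))) \<le> \<Phi> x (norm (v x /\<^sub>R e))"
        by (cases "norm (v x) > real n") (use nn in \<open>simp_all add: Phi_zero del: norm_scaleR\<close>)
    qed
  qed measurable
  from LIMSEQ_D[OF this zero_less_one]
  obtain N where N: "\<And>n. n \<ge> N \<Longrightarrow> norm ((LINT x|M. \<Phi> x (norm (?t n x /\<^sub>R e))) - (LINT x|M. 0)) < 1"
    by blast
  show "\<exists>no. \<forall>n\<ge>no. norm (nrm (?t n) - 0) < r"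
  proof (intro exI allI impI)
    fix n assume "n \<ge> N"
    then have "modular \<Omega> (phi \<alpha> \<gamma> \<kappa>) (\<lambda>x. ?t n x /\<^sub>R e) \<le> 1"
      unfolding modular_phi_eq_integral[OF it] using N[of n] by (simp add: ennreal_le_1 del: norm_scaleR)
    then have "nrm (?t n) \<le> e" using e by (intro nrm_le) auto
    moreover have "nrm (?t n) \<ge> 0" by (rule le_nrmI[OF tY]) simp
    ultimately show "norm (nrm (?t n) - 0) < r" using e by simp
  qed
qed

text \<open>Square integrable fields lie in \<open>Y\<close>, so the Riesz theorem on \<open>L\<^sup>2\<close> already produces \<open>p\<close>.
  Testing with the maximizers in Young's inequality for \<open>p / C\<close> bounds its conjugate modular by 1,
  and truncations, dense in \<open>Y\<close> because \<open>\<phi>\<^sub>\<gamma>\<close> is doubling, extend the representation to \<open>Y\<close>.\<close>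
theorem dual_space_representation:
  assumes l: "l \<in> dual_space Y nrm"
  obtains p where "p \<in> Z" "\<And>v. v \<in> Y \<Longrightarrow> l v = pairing \<Omega> p v"
proof -
  obtain C0 where ladd: "\<And>v w. v \<in> Y \<Longrightarrow> w \<in> Y \<Longrightarrow> l (\<lambda>x. v x + w x) = l v + l w"
    and lscale: "\<And>c v. v \<in> Y \<Longrightarrow> l (\<lambda>x. c *\<^sub>R v x) = c * l v"
    and C0: "\<And>v. v \<in> Y \<Longrightarrow> \<bar>l v\<bar> \<le> C0 * nrm v"
    using l unfolding dual_space_def by blast
  \<comment> \<open>C0 may be zero or negative, but p is divided by C below.\<close>
  define C where "C = max C0 1"
  have Cpos: "C > 0" by (simp add: C_def)
  have C: "\<bar>l v\<bar> \<le> C * nrm v" if "v \<in> Y" for v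
  proof -
    have "nrm v \<ge> 0" by (rule le_nrmI[OF that]) simp
    then have "C0 * nrm v \<le> C * nrm v" by (intro mult_right_mono) (auto simp: C_def)
    with C0[OF that] show ?thesis by linarith
  qed
  let ?V = "{v :: 'a \<Rightarrow> 'a. sq_integrable M v}"
  let ?B = "C * (\<alpha> + \<alpha> * \<gamma> / km)"
  have "?B > 0" using Cpos pos km_pos by (auto intro!: mult_pos_pos add_pos_pos divide_pos_pos)
  have "l v \<le> C * (1 + \<alpha> * measure M \<Omega>) + ?B * sq_int M v" if "v \<in> ?V" for v
  proof -
    have v: "sq_integrable M v" using that by simp
    have "l v \<le> C * nrm v" using C[OF sq_integrable_in_Y(1)[OF v]] by linarith
    also have "\<dots> \<le> C * (1 + (\<alpha> * measure M \<Omega> + (\<alpha> + \<alpha> * \<gamma> / km) * sq_int M v))"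
      using nrm_le_modular[OF sq_integrable_in_Y(1)[OF v]] sq_integrable_in_Y(2)[OF v] Cpos
      by (intro mult_left_mono) auto
    finally show ?thesis by (simp add: algebra_simps)
  qed
  note bound = this
  have "\<exists>d. sq_integrable M d \<and> (\<forall>u\<in>?V. l u = 2 * ?B * (LINT x|M. d x \<bullet> u x))"
  proof (rule L2_Riesz_on_subspace[of M ?V l ?B])
    have "sq_integrable M (\<lambda>_. 0 :: 'a)" by (simp add: sq_integrable_def)
    then show "?V \<noteq> {}" by blast
    show "finite_measure M" by unfold_locales
  qed (use bound \<open>?B > 0\<close> in \<open>auto simp: sq_integrable_add(1) sq_integrable_scaleR(1)
         ladd lscale sq_integrable_in_Y(1)\<close>)
  then obtain d where d: "sq_integrable M d" and
      repr0: "\<And>u. u \<in> ?V \<Longrightarrow> l u = 2 * ?B * (LINT x|M. d x \<bullet> u x)" by blast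
  define p where "p x = (2 * ?B) *\<^sub>R d x" for x
  have p: "sq_integrable M p" unfolding p_def by (rule sq_integrable_scaleR[OF d])
  then have pm [measurable]: "p \<in> borel_measurable M" by (simp add: sq_integrable_def)
  have repr: "l u = (LINT x|M. p x \<bullet> u x)" if "sq_integrable M u" for u
    using repr0[of u] that by (simp add: p_def)
  have pZ: "p \<in> Z"
  proof -
    let ?p = "\<lambda>x. inverse C *\<^sub>R p x"
    have p': "sq_integrable M ?p" by (rule sq_integrable_scaleR[OF p])
    then have p'm [measurable]: "?p \<in> borel_measurable M" by (simp add: sq_integrable_def)
    have "modular \<Omega> (phi_star \<alpha> \<gamma> \<kappa>) ?p \<le> 1"
      unfolding nn_integral_truncated_Psi[OF p'm]
    proof (rule SUP_least)
      fix n
      let ?J = "\<lambda>x. indicator {x. norm (?p x) \<le> real n} x * \<Psi> x (norm (?p x))"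
      obtain w where w: "w \<in> borel_measurable M" "\<And>x. norm (w x) \<le> kp * exp (real n / (\<alpha> * \<gamma>))"
        "\<And>x. ?p x \<bullet> w x = \<Phi> x (norm (w x)) + ?J x"
        using young_equality_truncated[OF p'm] by blast
      have w2: "sq_integrable M w" by (rule bounded_sq_integrable[OF w(1,2)])
      then have wY: "w \<in> Y" by (rule sq_integrable_in_Y)
      then have iw: "integrable M (\<lambda>x. \<Phi> x (norm (w x)))" by (simp add: Y_iff)
      have J: "?J = (\<lambda>x. ?p x \<bullet> w x - \<Phi> x (norm (w x)))" using w(3) by auto
      have iJ: "integrable M ?J" unfolding J using sq_integrable_inner[OF p' w2] iw by auto
      \<comment> \<open>The norm of w is at most 1 plus its modular; the modular cancels against the
        subtracted term and 1 remains.\<close>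
      have "(LINT x|M. ?J x) = inverse C * l w - (LINT x|M. \<Phi> x (norm (w x)))"
        unfolding J repr[OF w2] using sq_integrable_inner[OF p w2] iw by simp
      also have "inverse C * l w \<le> nrm w" using C[OF wY] Cpos by (simp add: field_simps)
      also have "nrm w \<le> 1 + (LINT x|M. \<Phi> x (norm (w x)))" by (rule nrm_le_modular[OF wY])
      finally have "(LINT x|M. ?J x) \<le> 1" by simp
      moreover have "(\<integral>\<^sup>+x. ennreal (?J x) \<partial>M) = ennreal (LINT x|M. ?J x)"
        using iJ by (intro nn_integral_eq_integral) (auto simp: Psi_nonneg)
      ultimately show "(\<integral>\<^sup>+x. ennreal (?J x) \<partial>M) \<le> 1" by (simp add: ennreal_le_1)
    qed
    then have "modular \<Omega> (phi_star \<alpha> \<gamma> \<kappa>) ?p < \<infinity>"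
      by (metis ennreal_one_less_top infinity_ennreal_def le_less_trans)
    with pm Cpos show ?thesis by (auto simp: MO_space_def intro!: exI[of _ "inverse C"])
  qed
  have "l v = pairing \<Omega> p v" if v: "v \<in> Y" for v
  proof (rule LIMSEQ_unique)
    have [measurable]: "v \<in> borel_measurable M" using v by (rule Y_measurable)
    \<comment> \<open>Both l v and the pairing are limits of l along these bounded truncations,
      where the representation is already known.\<close>
    let ?v = "\<lambda>n x. indicator {x. norm (v x) \<le> real n} x *\<^sub>R v x"
    let ?t = "\<lambda>n x. indicator {x. norm (v x) > real n} x *\<^sub>R v x"
    have v2: "sq_integrable M (?v n)" for n
      by (rule bounded_sq_integrable[where B = "real n"]) (auto simp: indicator_def)
    have tY: "?t n \<in> Y" for n by (rule Y_dominated[OF _ v]) (auto simp: indicator_def)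
    have split: "l v = l (?v n) + l (?t n)" for n
    proof -
      have "(\<lambda>x. ?v n x + ?t n x) = v" by (auto simp: indicator_def)
      then show ?thesis using ladd[OF sq_integrable_in_Y(1)[OF v2] tY, of n n] by simp
    qed
    have "(\<lambda>n. l (?t n)) \<longlonglongrightarrow> 0"
    proof (rule tendsto_rabs_zero_cancel, rule tendsto_sandwich[OF _ _ tendsto_const])
      show "(\<lambda>n. C * nrm (?t n)) \<longlonglongrightarrow> 0"
        using tendsto_mult_right_zero[OF nrm_tail_tendsto[OF v]] .
    qed (use C[OF tY] in auto)
    then have "(\<lambda>n. l v - l (?t n)) \<longlonglongrightarrow> l v - 0" by (intro tendsto_intros)
    moreover have "l v - l (?t n) = l (?v n)" for n using split[of n] by simp
    ultimately show "(\<lambda>n. l (?v n)) \<longlonglongrightarrow> l v" by simp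
    have "(\<lambda>n. LINT x|M. p x \<bullet> ?v n x) \<longlonglongrightarrow> (LINT x|M. p x \<bullet> v x)"
    proof (rule integral_dominated_convergence[where w = "\<lambda>x. \<bar>p x \<bullet> v x\<bar>"])
      show "AE x in M. (\<lambda>n. p x \<bullet> ?v n x) \<longlonglongrightarrow> p x \<bullet> v x"
      proof (rule AE_I2)
        fix x
        obtain N :: nat where "norm (v x) \<le> real N" using real_arch_simple by blast
        then show "(\<lambda>n. p x \<bullet> ?v n x) \<longlonglongrightarrow> p x \<bullet> v x"
          by (intro tendsto_eventually eventually_sequentiallyI[of N]) (auto simp: indicator_def)
      qed
      show "integrable M (\<lambda>x. \<bar>p x \<bullet> v x\<bar>)" using pairing_integrable[OF pZ v] by simp
    qed (auto simp: indicator_def)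
    then show "(\<lambda>n. l (?v n)) \<longlonglongrightarrow> pairing \<Omega> p v"
      unfolding repr[OF v2] pairing_def .
  qed
  with pZ show thesis using that by blast
qed

end

subsection \<open>Weak gradients and divergences\<close>

text \<open>The functions picked by \<open>SOME\<close> are known only to be locally integrable;
  their measurability on \<Omega> is glued together from countably many closed boxes.\<close>

lemma locally_integrable_measurable:
  fixes f :: "'a::euclidean_space \<Rightarrow> 'b::euclidean_space"
  assumes "open \<Omega>" "locally_integrable \<Omega> f"
  shows "f \<in> borel_measurable (lebesgue_on \<Omega>)"
proof -
  obtain \<D> where D: "countable \<D>" "\<D> \<subseteq> Pow \<Omega>" "\<And>X. X \<in> \<D> \<Longrightarrow> \<exists>a b. X = cbox a b" "\<Union>\<D> = \<Omega>"
    using open_countable_Union_open_cbox[OF \<open>open \<Omega>\<close>] by blast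
  show ?thesis
  proof (rule measurable_piecewise_restrict[OF D(1)])
    fix X assume X: "X \<in> \<D>"
    then obtain a b where ab: "X = cbox a b" "X \<subseteq> \<Omega>" using D(2,3) by blast
    then show "X \<inter> space (lebesgue_on \<Omega>) \<in> sets (lebesgue_on \<Omega>)"
      using \<open>open \<Omega>\<close> by (auto simp: sets_restrict_space_iff Int_absorb2)
    have "f absolutely_integrable_on X" using assms(2) ab by (auto simp: locally_integrable_def)
    then have "f \<in> borel_measurable (lebesgue_on X)"
      using ab(1) by (subst (asm) absolutely_integrable_measurable) auto
    then show "f \<in> borel_measurable (restrict_space (lebesgue_on \<Omega>) X)"
      using ab \<open>open \<Omega>\<close> by (simp add: restrict_restrict_space Int_absorb1)
  qed (use D(4) in auto)
qed

lemma integrable_imp_locally_integrable: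
  fixes f :: "'a::euclidean_space \<Rightarrow> 'b::euclidean_space"
  assumes "open \<Omega>" "integrable (lebesgue_on \<Omega>) f"
  shows "locally_integrable \<Omega> f"
  unfolding locally_integrable_def set_integrable_def
proof (intro allI impI)
  fix C :: "'a set" assume C: "compact C \<and> C \<subseteq> \<Omega>"
  then have Cm: "C \<in> sets lebesgue" using compact_imp_closed by (metis borel_closed sets_completionI_sets sets_lborel)
  have "integrable lebesgue (\<lambda>x. indicator \<Omega> x *\<^sub>R f x)"
    using assms by (subst (asm) integrable_restrict_space) auto
  from integrable_mult_indicator[OF Cm this]
  have "integrable lebesgue (\<lambda>x. indicator C x *\<^sub>R indicator \<Omega> x *\<^sub>R f x)" .
  moreover have "(\<lambda>x. indicator C x *\<^sub>R indicator \<Omega> x *\<^sub>R f x) = (\<lambda>x. indicator C x *\<^sub>R f x)"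
    using C by (auto simp: indicator_def fun_eq_iff)
  ultimately show "integrable lebesgue (\<lambda>x. indicator C x *\<^sub>R f x)" by (simp only:)
qed

lemma locally_integrable_add:
  "locally_integrable \<Omega> f \<Longrightarrow> locally_integrable \<Omega> g \<Longrightarrow> locally_integrable \<Omega> (\<lambda>x. f x + g x)"
  unfolding locally_integrable_def by (auto intro: set_integral_add(1))

lemma locally_integrable_scaleR:
  "locally_integrable \<Omega> f \<Longrightarrow> locally_integrable \<Omega> (\<lambda>x. c *\<^sub>R f x)"
  unfolding locally_integrable_def by (auto intro: absolutely_integrable_scaleR_left)

lemma locally_integrable_diff:
  "locally_integrable \<Omega> f \<Longrightarrow> locally_integrable \<Omega> g \<Longrightarrow> locally_integrable \<Omega> (\<lambda>x. f x - g x)"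
  unfolding locally_integrable_def by (auto intro: set_integral_diff(1))

lemma locally_integrable_inner:
  "locally_integrable \<Omega> f \<Longrightarrow> locally_integrable \<Omega> (\<lambda>x. f x \<bullet> b)"
  unfolding locally_integrable_def set_integrable_def
  by (auto simp flip: inner_scaleR_left intro!: integrable_inner_left)

lemma integrable_compact_dominated:
  fixes g :: "'a::euclidean_space \<Rightarrow> 'b::euclidean_space" and h :: "'a \<Rightarrow> 'c::euclidean_space"
  assumes \<Omega>: "open \<Omega>" and g: "locally_integrable \<Omega> g" and K: "compact K" "K \<subseteq> \<Omega>"
    and h: "h \<in> borel_measurable (lebesgue_on \<Omega>)" "\<And>x. norm (h x) \<le> B * norm (g x)" "\<And>x. x \<notin> K \<Longrightarrow> h x = 0"
  shows "integrable (lebesgue_on \<Omega>) h"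
proof (rule Bochner_Integration.integrable_bound)
  have "integrable lebesgue (\<lambda>x. indicator K x *\<^sub>R g x)"
    using g K by (auto simp: locally_integrable_def set_integrable_def)
  moreover have "(\<lambda>x. indicator K x *\<^sub>R g x) = (\<lambda>x. indicator \<Omega> x *\<^sub>R indicator K x *\<^sub>R g x)"
    using K by (auto simp: indicator_def fun_eq_iff)
  ultimately have "integrable (lebesgue_on \<Omega>) (\<lambda>x. indicator K x *\<^sub>R g x)"
    using \<Omega> by (subst integrable_restrict_space) auto
  then show "integrable (lebesgue_on \<Omega>) (\<lambda>x. B * norm (indicator K x *\<^sub>R g x))"
    by (intro integrable_mult_right integrable_norm)
  show "AE x in lebesgue_on \<Omega>. norm (h x) \<le> norm (B * norm (indicator K x *\<^sub>R g x))"
  proof (rule AE_I2)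
    fix x
    show "norm (h x) \<le> norm (B * norm (indicator K x *\<^sub>R g x))"
    proof (cases "x \<in> K")
      case True
      have "norm (h x) \<le> B * norm (g x)" by (rule h(2))
      also have "\<dots> \<le> norm (B * norm (g x))" by simp
      finally show ?thesis using True by simp
    qed (simp add: h(3))
  qed
qed (rule h(1))

lemma continuous_on_UNIV_lebesgue_on_measurable:
  fixes f :: "'a::euclidean_space \<Rightarrow> 'b::euclidean_space"
  assumes "continuous_on UNIV f" "open \<Omega>" shows "f \<in> borel_measurable (lebesgue_on \<Omega>)"
  using locally_integrable_measurable[OF assms(2) locally_integrable_continuous[OF assms(1)]] .

lemma test_function_mult_integrable:
  fixes g :: "'a::euclidean_space \<Rightarrow> 'b::euclidean_space"
  assumes \<Omega>: "open \<Omega>" and g: "locally_integrable \<Omega> g" and \<phi>: "\<phi> \<in> test_functions \<Omega>"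
  shows "integrable (lebesgue_on \<Omega>) (\<lambda>x. \<phi> x *\<^sub>R g x)"
proof -
  obtain K where K: "compact K" "K \<subseteq> \<Omega>" "\<And>x. x \<notin> K \<Longrightarrow> \<phi> x = 0" using test_function_support[OF \<phi>] by blast
  note c = test_function_C1(2)[OF \<phi>]
  obtain B where B: "\<And>x. norm (\<phi> x) \<le> B" using compact_support_bounded[OF K(1) c K(3)] by blast
  have [measurable]: "\<phi> \<in> borel_measurable (lebesgue_on \<Omega>)" "g \<in> borel_measurable (lebesgue_on \<Omega>)"
    using continuous_on_UNIV_lebesgue_on_measurable[OF c \<Omega>] locally_integrable_measurable[OF \<Omega> g] by auto
  show ?thesis
  proof (rule integrable_compact_dominated[OF \<Omega> g K(1,2)])
    show "norm (\<phi> x *\<^sub>R g x) \<le> B * norm (g x)" for x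
      using mult_right_mono[OF B norm_ge_zero] by simp
  qed (use K(3) in auto)
qed

lemma test_function_grad_mult_integrable:
  fixes u :: "'a::euclidean_space \<Rightarrow> real"
  assumes \<Omega>: "open \<Omega>" and u: "locally_integrable \<Omega> u" and \<phi>: "\<phi> \<in> test_functions \<Omega>"
  shows "integrable (lebesgue_on \<Omega>) (\<lambda>x. u x *\<^sub>R grad \<phi> x)"
proof -
  obtain K where K: "compact K" "K \<subseteq> \<Omega>" "\<And>x. x \<notin> K \<Longrightarrow> grad \<phi> x = 0" using test_function_support[OF \<phi>] by blast
  note c = test_function_C1(3)[OF \<phi>]
  obtain B where B: "\<And>x. norm (grad \<phi> x) \<le> B" using compact_support_bounded[OF K(1) c K(3)] by blast
  have [measurable]: "grad \<phi> \<in> borel_measurable (lebesgue_on \<Omega>)" "u \<in> borel_measurable (lebesgue_on \<Omega>)"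
    using continuous_on_UNIV_lebesgue_on_measurable[OF c \<Omega>] locally_integrable_measurable[OF \<Omega> u] by auto
  show ?thesis
  proof (rule integrable_compact_dominated[OF \<Omega> u K(1,2)])
    show "norm (u x *\<^sub>R grad \<phi> x) \<le> B * norm (u x)" for x
      using mult_left_mono[OF B norm_ge_zero, of "u x" x] by (simp add: mult.commute)
  qed (use K(3) in auto)
qed

text \<open>The scalar fundamental lemma in each component. It makes the choices in
  \<open>weak_grad\<close> and \<open>distr_div\<close> immaterial up to null sets.\<close>

lemma AE_eq_if_test_integrals_eq:
  fixes g g' :: "'a::euclidean_space \<Rightarrow> 'b::euclidean_space"
  assumes \<Omega>: "open \<Omega>" and g: "locally_integrable \<Omega> g" "locally_integrable \<Omega> g'"
    and eq: "\<And>\<phi>. \<phi> \<in> test_functions \<Omega> \<Longrightarrow>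
      (LINT x|lebesgue_on \<Omega>. \<phi> x *\<^sub>R g x) = (LINT x|lebesgue_on \<Omega>. \<phi> x *\<^sub>R g' x)"
  shows "AE x in lebesgue_on \<Omega>. g x = g' x"
proof -
  have "AE x in lebesgue_on \<Omega>. (g x - g' x) \<bullet> b = 0" for b
  proof (rule AE_zero_if_test_integrals_zero[OF \<Omega>])
    show "locally_integrable \<Omega> (\<lambda>x. (g x - g' x) \<bullet> b)"
      by (intro locally_integrable_inner locally_integrable_diff g)
    fix \<phi> assume \<phi>: "\<phi> \<in> test_functions \<Omega>"
    note i = test_function_mult_integrable[OF \<Omega> g(1) \<phi>] test_function_mult_integrable[OF \<Omega> g(2) \<phi>]
    have "(LINT x|lebesgue_on \<Omega>. (g x - g' x) \<bullet> b * \<phi> x) = (LINT x|lebesgue_on \<Omega>. (\<phi> x *\<^sub>R g x - \<phi> x *\<^sub>R g' x) \<bullet> b)"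
      by (intro Bochner_Integration.integral_cong) (auto simp: inner_diff_left algebra_simps)
    also have "\<dots> = (LINT x|lebesgue_on \<Omega>. \<phi> x *\<^sub>R g x - \<phi> x *\<^sub>R g' x) \<bullet> b"
      using i by (intro integral_inner_left) auto
    also have "\<dots> = 0" using i eq[OF \<phi>] by simp
    finally show "(LINT x|lebesgue_on \<Omega>. (g x - g' x) \<bullet> b * \<phi> x) = 0" .
  qed
  then have "AE x in lebesgue_on \<Omega>. \<forall>b\<in>Basis. (g x - g' x) \<bullet> b = 0"
    by (intro AE_finite_allI) auto
  then show ?thesis
    by eventually_elim (simp add: euclidean_eq_iff[of "g _"] inner_diff_left)
qed

lemma has_weak_grad_unique:
  assumes "open \<Omega>" "has_weak_grad \<Omega> u g" "has_weak_grad \<Omega> u g'"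
  shows "AE x in lebesgue_on \<Omega>. g x = g' x"
  using assms unfolding has_weak_grad_def by (intro AE_eq_if_test_integrals_eq) auto

lemma has_distr_div_unique:
  assumes "open \<Omega>" "has_distr_div \<Omega> p d" "has_distr_div \<Omega> p d'"
  shows "AE x in lebesgue_on \<Omega>. d x = d' x"
  using assms unfolding has_distr_div_def
  by (intro AE_eq_if_test_integrals_eq) (auto simp: mult.commute)

lemma has_weak_grad_add:
  assumes \<Omega>: "open \<Omega>" and u: "has_weak_grad \<Omega> u g" and v: "has_weak_grad \<Omega> v h"
  shows "has_weak_grad \<Omega> (\<lambda>x. u x + v x) (\<lambda>x. g x + h x)"
proof -
  have loc: "locally_integrable \<Omega> u" "locally_integrable \<Omega> g" "locally_integrable \<Omega> v" "locally_integrable \<Omega> h"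
    using u v by (auto simp: has_weak_grad_def)
  have "(LINT x|lebesgue_on \<Omega>. (u x + v x) *\<^sub>R grad \<phi> x) = - (LINT x|lebesgue_on \<Omega>. \<phi> x *\<^sub>R (g x + h x))"
    if \<phi>: "\<phi> \<in> test_functions \<Omega>" for \<phi>
    using u v \<phi> test_function_mult_integrable[OF \<Omega> loc(2) \<phi>] test_function_mult_integrable[OF \<Omega> loc(4) \<phi>]
      test_function_grad_mult_integrable[OF \<Omega> loc(1) \<phi>] test_function_grad_mult_integrable[OF \<Omega> loc(3) \<phi>]
    by (simp add: has_weak_grad_def scaleR_add_left scaleR_add_right)
  with loc show ?thesis by (simp add: has_weak_grad_def locally_integrable_add)
qed

lemma has_weak_grad_scale:
  assumes "has_weak_grad \<Omega> u g"
  shows "has_weak_grad \<Omega> (\<lambda>x. c * u x) (\<lambda>x. c *\<^sub>R g x)"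
proof -
  have "(LINT x|lebesgue_on \<Omega>. (c * u x) *\<^sub>R grad \<phi> x) = - (LINT x|lebesgue_on \<Omega>. \<phi> x *\<^sub>R c *\<^sub>R g x)"
    if "\<phi> \<in> test_functions \<Omega>" for \<phi>
  proof -
    have "(LINT x|lebesgue_on \<Omega>. (c * u x) *\<^sub>R grad \<phi> x) = c *\<^sub>R (LINT x|lebesgue_on \<Omega>. u x *\<^sub>R grad \<phi> x)"
      by (simp flip: scaleR_scaleR)
    also have "\<dots> = - (c *\<^sub>R (LINT x|lebesgue_on \<Omega>. \<phi> x *\<^sub>R g x))"
      using assms that by (simp add: has_weak_grad_def)
    also have "c *\<^sub>R (LINT x|lebesgue_on \<Omega>. \<phi> x *\<^sub>R g x) = (LINT x|lebesgue_on \<Omega>. \<phi> x *\<^sub>R c *\<^sub>R g x)"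
      unfolding scaleR_left_commute[of _ c] by (rule integral_scaleR_right[symmetric])
    finally show ?thesis .
  qed
  then show ?thesis
    using assms locally_integrable_scaleR[of \<Omega> u c] locally_integrable_scaleR[of \<Omega> g c]
    by (simp add: has_weak_grad_def)
qed

lemma L2_iff: "u \<in> L2 \<Omega> \<longleftrightarrow> sq_integrable (lebesgue_on \<Omega>) u"
  by (simp add: L2_def sq_integrable_def)

lemma L2_norm_sq: "(L2_norm \<Omega> u)\<^sup>2 = sq_int (lebesgue_on \<Omega>) u"
  by (simp add: L2_norm_def sq_int_def)

subsection \<open>The dual problem\<close>

context musielak_orlicz
begin

abbreviation "X \<equiv> X_space \<Omega> \<alpha> \<gamma> \<kappa>"
abbreviation "wgrad \<equiv> weak_grad \<Omega>"
abbreviation "K \<equiv> K_set \<Omega> \<alpha> \<gamma> \<kappa>"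

section \<open>The space X and the linearity of the pairing with gradients\<close>

lemma sq_integrable_integrable:
  fixes u :: "'a \<Rightarrow> real" assumes "sq_integrable M u" shows "integrable M u"
proof -
  have "sq_integrable M (\<lambda>_::'a. 1::real)" by (simp add: sq_integrable_def)
  from sq_integrable_inner[OF assms this] show ?thesis by simp
qed

lemma Y_imp_integrable:
  assumes "v \<in> Y" shows "integrable M v"
proof (rule Bochner_Integration.integrable_bound)
  show "integrable M (\<lambda>x. \<Phi> x (norm (v x)) / \<alpha>)" "v \<in> borel_measurable M" using assms by (auto simp: Y_iff)
  show "AE x in M. norm (v x) \<le> norm (\<Phi> x (norm (v x)) / \<alpha>)"
  proof (rule AE_I2)
    fix x
    have "\<alpha> * norm (v x) \<le> \<Phi> x (norm (v x))" by (rule phr_lower[OF pos norm_ge_zero])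
    then have "norm (v x) \<le> \<Phi> x (norm (v x)) / \<alpha>" using pos by (simp add: field_simps)
    then show "norm (v x) \<le> norm (\<Phi> x (norm (v x)) / \<alpha>)" unfolding real_norm_def by linarith
  qed
qed

lemma X_D:
  assumes "u \<in> X"
  shows "sq_integrable M u" "has_weak_grad \<Omega> u (wgrad u)" "wgrad u \<in> Y"
proof -
  show "sq_integrable M u" using assms by (simp add: X_space_def L2_iff)
  have "\<exists>g. has_weak_grad \<Omega> u g" using assms by (auto simp: X_space_def W11_def)
  then show g: "has_weak_grad \<Omega> u (wgrad u)" unfolding weak_grad_def by (rule someI_ex)
  have "wgrad u \<in> borel_measurable M"
    using g by (intro locally_integrable_measurable[OF open_domain]) (simp add: has_weak_grad_def)
  with assms show "wgrad u \<in> Y" by (simp add: Y_iff X_space_def flip: integrable_iff_modular_phi)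
qed

text \<open>Any weak gradient in Y certifies membership, as it agrees almost everywhere with the
  chosen one. The L^1 conditions of \<open>W11\<close> follow: L^2 lies in L^1 by finiteness of the
  measure, and so does Y by the linear lower bound.\<close>

lemma X_I:
  assumes u: "sq_integrable M u" and g: "has_weak_grad \<Omega> u g" "g \<in> Y"
  shows "u \<in> X" "AE x in M. wgrad u x = g x"
proof -
  have "has_weak_grad \<Omega> u (wgrad u)" unfolding weak_grad_def by (rule someI[of "has_weak_grad \<Omega> u", OF g(1)])
  then show ae: "AE x in M. wgrad u x = g x" by (rule has_weak_grad_unique[OF open_domain _ g(1)])
  have "modular \<Omega> (phi \<alpha> \<gamma> \<kappa>) (wgrad u) = modular \<Omega> (phi \<alpha> \<gamma> \<kappa>) g"
    unfolding modular_phi by (rule nn_integral_cong_AE) (use ae in \<open>eventually_elim, simp\<close>)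
  moreover have "modular \<Omega> (phi \<alpha> \<gamma> \<kappa>) g < \<infinity>"
    using g(2) integrable_iff_modular_phi by (simp add: Y_iff)
  ultimately show "u \<in> X"
    using u g Y_imp_integrable[OF g(2)] sq_integrable_integrable[OF u]
    by (auto simp: X_space_def L2_iff W11_def)
qed

lemma X_add:
  assumes "u \<in> X" "v \<in> X"
  shows "(\<lambda>x. u x + v x) \<in> X" "AE x in M. wgrad (\<lambda>x. u x + v x) x = wgrad u x + wgrad v x"
  using X_I[OF sq_integrable_add(1)[OF X_D(1)[OF assms(1)] X_D(1)[OF assms(2)]]
      has_weak_grad_add[OF open_domain X_D(2)[OF assms(1)] X_D(2)[OF assms(2)]]
      Y_add[OF X_D(3)[OF assms(1)] X_D(3)[OF assms(2)]]]
  by auto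

lemma X_scale:
  assumes "u \<in> X"
  shows "(\<lambda>x. c * u x) \<in> X" "AE x in M. wgrad (\<lambda>x. c * u x) x = c *\<^sub>R wgrad u x"
  using X_I[OF sq_integrable_scaleR(1)[OF X_D(1)[OF assms], of c, unfolded real_scaleR_def]
      has_weak_grad_scale[OF X_D(2)[OF assms], of c] Y_scale[OF X_D(3)[OF assms], of c]]
  by auto

lemma test_functions_in_X:
  assumes \<phi>: "\<phi> \<in> test_functions \<Omega>"
  shows "\<phi> \<in> X" "AE x in M. wgrad \<phi> x = grad \<phi> x"
proof -
  obtain C where C: "compact C" "C \<subseteq> \<Omega>" "\<And>x. x \<notin> C \<Longrightarrow> \<phi> x = 0" "\<And>x. x \<notin> C \<Longrightarrow> grad \<phi> x = 0"
    using test_function_support[OF \<phi>] by blast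
  note c = test_function_C1(2,3)[OF \<phi>]
  note m = continuous_on_UNIV_lebesgue_on_measurable[OF c(1) open_domain]
    continuous_on_UNIV_lebesgue_on_measurable[OF c(2) open_domain]
  obtain B where "\<And>x. norm (\<phi> x) \<le> B" using compact_support_bounded[OF C(1) c(1) C(3)] by blast
  then have "sq_integrable M \<phi>" by (rule bounded_sq_integrable[OF m(1)])
  moreover obtain B' where "\<And>x. norm (grad \<phi> x) \<le> B'" using compact_support_bounded[OF C(1) c(2) C(4)] by blast
  then have "sq_integrable M (grad \<phi>)" by (rule bounded_sq_integrable[OF m(2)])
  then have "grad \<phi> \<in> Y" by (rule sq_integrable_in_Y)
  ultimately show "\<phi> \<in> X" "AE x in M. wgrad \<phi> x = grad \<phi> x"
    using X_I[OF _ test_function_has_weak_grad[OF open_domain \<phi>]] by blast+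
qed

lemma zero_in_X: "(\<lambda>_. 0) \<in> X"
proof -
  have "(\<lambda>_. 0 :: real) \<in> test_functions \<Omega>"
  proof -
    have "continuously_diff k (\<lambda>_::'a. 0)" for k
      by (induction k) (auto intro: GDERIV_const)
    then show ?thesis by (simp add: test_functions_def)
  qed
  then show ?thesis by (rule test_functions_in_X)
qed

lemma pairing_cong_AE:
  assumes "p \<in> borel_measurable M" "v \<in> borel_measurable M" "w \<in> borel_measurable M"
    and "AE x in M. v x = w x"
  shows "pairing \<Omega> p v = pairing \<Omega> p w"
  unfolding pairing_def
  by (rule integral_cong_AE) (use assms in \<open>auto elim: eventually_mono\<close>)

lemma pairing_grad_add:
  assumes p: "p \<in> Z" and "u \<in> X" "v \<in> X"
  shows "pairing \<Omega> p (wgrad (\<lambda>x. u x + v x)) = pairing \<Omega> p (wgrad u) + pairing \<Omega> p (wgrad v)"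
proof -
  note Y = X_D(3)[OF assms(2)] X_D(3)[OF assms(3)]
  have "pairing \<Omega> p (wgrad (\<lambda>x. u x + v x)) = pairing \<Omega> p (\<lambda>x. wgrad u x + wgrad v x)"
    using X_add(2)[OF assms(2,3)]
    by (intro pairing_cong_AE Z_measurable p Y_measurable Y_add X_D(3) X_add(1) assms)
  also have "\<dots> = pairing \<Omega> p (wgrad u) + pairing \<Omega> p (wgrad v)"
    using pairing_integrable[OF p] Y by (simp add: pairing_def inner_add_right)
  finally show ?thesis .
qed

lemma pairing_grad_scale:
  assumes p: "p \<in> Z" and "u \<in> X"
  shows "pairing \<Omega> p (wgrad (\<lambda>x. c * u x)) = c * pairing \<Omega> p (wgrad u)"
proof -
  have "pairing \<Omega> p (wgrad (\<lambda>x. c * u x)) = pairing \<Omega> p (\<lambda>x. c *\<^sub>R wgrad u x)"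
    using X_scale(2)[OF assms(2)]
    by (intro pairing_cong_AE Z_measurable p Y_measurable Y_scale X_D(3) X_scale(1) assms)
  then show ?thesis by (simp add: pairing_def)
qed

lemma X_Riesz:
  assumes B: "B > 0"
    and add: "\<And>u v. u \<in> X \<Longrightarrow> v \<in> X \<Longrightarrow> l (\<lambda>x. u x + v x) = l u + l v"
    and scale: "\<And>c u. u \<in> X \<Longrightarrow> l (\<lambda>x. c * u x) = c * l u"
    and bound: "\<And>u. u \<in> X \<Longrightarrow> l u \<le> A + B * sq_int M u"
  obtains d s where "sq_integrable M d" "\<And>n::nat. s n \<in> X"
    "(\<lambda>n. sq_int M (\<lambda>x. s n x - d x)) \<longlonglongrightarrow> 0"
    "\<And>u. u \<in> X \<Longrightarrow> l u = 2 * B * (LINT x|M. d x * u x)"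
proof (rule L2_Riesz_on_subspace[of M X l B A])
  show "finite_measure M" by unfold_locales
  show "X \<noteq> {}" using zero_in_X by blast
qed (use assms X_D(1) X_add(1) X_scale(1) that in auto)

text \<open>An element of \<open>L\<^sup>2\<close> orthogonal to all test functions vanishes, so the Riesz representative
  of \<open>u \<mapsto> \<integral> w u\<close> on \<open>X\<close>, which is an \<open>L\<^sup>2\<close> limit of elements of \<open>X\<close>, is \<open>w\<close> itself.\<close>
lemma X_dense_L2:
  fixes w :: "'a \<Rightarrow> real"
  assumes w: "sq_integrable M w"
  obtains s where "\<And>n::nat. s n \<in> X" "(\<lambda>n. sq_int M (\<lambda>x. s n x - w x)) \<longlonglongrightarrow> 0"
proof -
  have i: "integrable M (\<lambda>x. w x * u x)" if "sq_integrable M u" for u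
    using sq_integrable_inner[OF w that] by simp
  \<comment> \<open>This is 0 <= |w - u|^2. The coefficient 1/2 makes the factor 2 B in the Riesz
    formula equal to 1.\<close>
  have "(LINT x|M. w x * u x) \<le> sq_int M w / 2 + 1/2 * sq_int M u" if "u \<in> X" for u
    using sq_integrable_diff(2)[OF w X_D(1)[OF that]] sq_int_nonneg[of M "\<lambda>x. w x - u x"] by simp
  then obtain d s where d: "sq_integrable M d" and s: "\<And>n::nat. s n \<in> X"
    "(\<lambda>n. sq_int M (\<lambda>x. s n x - d x)) \<longlonglongrightarrow> 0"
    and eq: "\<And>u. u \<in> X \<Longrightarrow> (LINT x|M. w x * u x) = 2 * (1/2) * (LINT x|M. d x * u x)"
    by (rule X_Riesz[of "1/2" "\<lambda>u. LINT x|M. w x * u x" "sq_int M w / 2", rotated 3])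
       (use i X_D(1) in \<open>auto simp: distrib_left mult.left_commute\<close>)
  have "AE x in M. d x = w x"
  proof (rule AE_eq_if_test_integrals_eq[OF open_domain])
    show "locally_integrable \<Omega> d" "locally_integrable \<Omega> w"
      by (intro integrable_imp_locally_integrable[OF open_domain] sq_integrable_integrable d w)+
    show "(LINT x|M. \<phi> x *\<^sub>R d x) = (LINT x|M. \<phi> x *\<^sub>R w x)" if "\<phi> \<in> test_functions \<Omega>" for \<phi>
      using eq[OF test_functions_in_X(1)[OF that]] by (simp add: mult.commute)
  qed
  then have "sq_int M (\<lambda>x. s n x - d x) = sq_int M (\<lambda>x. s n x - w x)" for n
    unfolding sq_int_def using X_D(1)[OF s(1), of n] d w
    by (intro integral_cong_AE) (auto simp: sq_integrable_def elim: eventually_mono)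
  with s have "(\<lambda>n. sq_int M (\<lambda>x. s n x - w x)) \<longlonglongrightarrow> 0" by simp
  with s(1) show thesis by (rule that)
qed

section \<open>The conjugate of F\<close>

lemma distr_div_eq:
  assumes "has_distr_div \<Omega> p d" and d: "sq_integrable M d"
  shows "AE x in M. distr_div \<Omega> p x = d x" "sq_integrable M (distr_div \<Omega> p)"
proof -
  have h: "has_distr_div \<Omega> p (distr_div \<Omega> p)" unfolding distr_div_def by (rule someI[of "has_distr_div \<Omega> p", OF assms(1)])
  then show ae: "AE x in M. distr_div \<Omega> p x = d x" by (rule has_distr_div_unique[OF open_domain _ assms(1)])
  have m: "distr_div \<Omega> p \<in> borel_measurable M"
    using h by (intro locally_integrable_measurable[OF open_domain]) (simp add: has_distr_div_def)
  moreover have "integrable M (\<lambda>x. (norm (distr_div \<Omega> p x))\<^sup>2)"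
    using d ae m by (subst integrable_cong_AE[where g = "\<lambda>x. (norm (d x))\<^sup>2"])
       (auto simp: sq_integrable_def elim: eventually_mono)
  ultimately show "sq_integrable M (distr_div \<Omega> p)" by (simp add: sq_integrable_def)
qed

lemma conjugate_F_in_K:
  assumes f: "sq_integrable M f" and p: "p \<in> K"
  shows "fenchel_conj X (F_fun \<Omega> f) (\<lambda>u. - (pairing \<Omega> p \<circ> wgrad) u) =
    ereal (1/2 * (L2_norm \<Omega> (distr_div \<Omega> p))\<^sup>2 + (LINT x|M. f x * distr_div \<Omega> p x))"
proof -
  let ?d = "distr_div \<Omega> p"
  have d: "sq_integrable M ?d" using p distr_div_eq(2) by (auto simp: K_set_def L2_iff)
  have parts: "pairing \<Omega> p (wgrad u) = - (LINT x|M. ?d x * u x)" if "u \<in> X" for u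
    using p that by (simp add: K_set_def pairing_def)
  \<comment> \<open>The maximizer of the quadratic over all of L^2. It need not lie in X, so density
    is what makes the supremum over X equal to c.\<close>
  define w where "w x = f x + ?d x" for x
  have w: "sq_integrable M w" unfolding w_def by (rule sq_integrable_add[OF f d])
  define c where "c = 1/2 * sq_int M ?d + (LINT x|M. f x * ?d x)"
  have val: "ereal (- (pairing \<Omega> p \<circ> wgrad) u) - F_fun \<Omega> f u = ereal (c - 1/2 * sq_int M (\<lambda>x. u x - w x))"
    if u: "u \<in> X" for u
  proof -
    note u2 = X_D(1)[OF u]
    have "(LINT x|M. u x \<bullet> w x) = (LINT x|M. u x \<bullet> f x) + (LINT x|M. ?d x * u x)"
      using sq_integrable_inner[OF u2 f] sq_integrable_inner[OF u2 d]
      by (simp add: w_def distrib_left mult.commute)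
    moreover have "sq_int M w = sq_int M f + 2 * (LINT x|M. f x * ?d x) + sq_int M ?d"
      using sq_integrable_add(2)[OF f d] by (simp add: w_def[abs_def])
    ultimately show ?thesis
      using sq_integrable_diff(2)[OF u2 w] sq_integrable_diff(2)[OF u2 f]
      by (simp add: F_fun_def L2_norm_sq parts[OF u] c_def field_simps)
  qed
  have "(SUP u\<in>X. ereal (- (pairing \<Omega> p \<circ> wgrad) u) - F_fun \<Omega> f u) = ereal c"
  proof (rule antisym)
    show "(SUP u\<in>X. ereal (- (pairing \<Omega> p \<circ> wgrad) u) - F_fun \<Omega> f u) \<le> ereal c"
      by (rule SUP_least) (simp only: val ereal_less_eq, simp add: sq_int_nonneg)
    obtain s where s: "\<And>n::nat. s n \<in> X" "(\<lambda>n. sq_int M (\<lambda>x. s n x - w x)) \<longlonglongrightarrow> 0"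
      using X_dense_L2[OF w] by blast
    have "(\<lambda>n. ereal (c - 1/2 * sq_int M (\<lambda>x. s n x - w x))) \<longlonglongrightarrow> ereal (c - 1/2 * 0)"
      by (intro tendsto_intros s(2))
    then have "(\<lambda>n. ereal (c - 1/2 * sq_int M (\<lambda>x. s n x - w x))) \<longlonglongrightarrow> ereal c" by simp
    then show "ereal c \<le> (SUP u\<in>X. ereal (- (pairing \<Omega> p \<circ> wgrad) u) - F_fun \<Omega> f u)"
    proof (rule LIMSEQ_le_const2)
      show "\<exists>N. \<forall>n\<ge>N. ereal (c - 1/2 * sq_int M (\<lambda>x. s n x - w x)) \<le>
          (SUP u\<in>X. ereal (- (pairing \<Omega> p \<circ> wgrad) u) - F_fun \<Omega> f u)"
        by (intro exI[of _ 0] allI impI) (subst val[OF s(1), symmetric], rule SUP_upper[OF s(1)])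
    qed
  qed
  then show ?thesis by (simp add: fenchel_conj_def c_def L2_norm_sq)
qed

lemma conjugate_F_notin_K:
  assumes f: "sq_integrable M f" and p: "p \<in> Z" "p \<notin> K"
  shows "fenchel_conj X (F_fun \<Omega> f) (\<lambda>u. - (pairing \<Omega> p \<circ> wgrad) u) = \<infinity>"
proof (rule ccontr)
  let ?C = "fenchel_conj X (F_fun \<Omega> f) (\<lambda>u. - (pairing \<Omega> p \<circ> wgrad) u)"
  assume "?C \<noteq> \<infinity>"
  then obtain c where c: "?C \<le> ereal c" by (cases ?C) auto
  have "- pairing \<Omega> p (wgrad u) \<le> (c + sq_int M f) + 1 * sq_int M u" if u: "u \<in> X" for u
  proof -
    have "ereal (- (pairing \<Omega> p \<circ> wgrad) u) - F_fun \<Omega> f u \<le> ?C"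
      unfolding fenchel_conj_def by (rule SUP_upper[OF u])
    then have "ereal (- (pairing \<Omega> p \<circ> wgrad) u) - F_fun \<Omega> f u \<le> ereal c" using c by (rule order_trans)
    then have "- pairing \<Omega> p (wgrad u) - 1/2 * sq_int M (\<lambda>x. u x - f x) \<le> c"
      by (simp add: F_fun_def L2_norm_sq)
    \<comment> \<open>This is 0 <= |u + f|^2 rewritten; halving it gives the constant B = 1.\<close>
    moreover have "sq_int M (\<lambda>x. u x - f x) \<le> 2 * sq_int M u + 2 * sq_int M f"
      using sq_integrable_diff(2)[OF X_D(1)[OF u] f] sq_integrable_add(2)[OF X_D(1)[OF u] f]
        sq_int_nonneg[of M "\<lambda>x. u x + f x"] by simp
    ultimately show ?thesis by linarith
  qed
  then obtain d s where d: "sq_integrable M d" and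
    eq: "\<And>u. u \<in> X \<Longrightarrow> - pairing \<Omega> p (wgrad u) = 2 * 1 * (LINT x|M. d x * u x)"
    by (rule X_Riesz[of 1 "\<lambda>u. - pairing \<Omega> p (wgrad u)" "c + sq_int M f", rotated 3])
       (auto simp: pairing_grad_add pairing_grad_scale p)
  \<comment> \<open>Absorbs the factor 2 B of the Riesz formula; restricting the identity to test
    functions then shows that e is the divergence of p.\<close>
  define e where "e x = 2 * d x" for x
  have e: "sq_integrable M e" using sq_integrable_scaleR(1)[OF d, of 2] by (simp add: e_def[abs_def])
  have eq: "pairing \<Omega> p (wgrad u) = - (LINT x|M. e x * u x)" if "u \<in> X" for u
    using eq[OF that] by (simp add: e_def mult.assoc)
  have div: "has_distr_div \<Omega> p e"
    unfolding has_distr_div_def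
  proof (intro conjI ballI)
    show "locally_integrable \<Omega> p" "locally_integrable \<Omega> e"
      by (intro integrable_imp_locally_integrable[OF open_domain] Z_integrable p sq_integrable_integrable e)+
    fix \<phi> assume \<phi>: "\<phi> \<in> test_functions \<Omega>"
    have "(LINT x|M. p x \<bullet> grad \<phi> x) = pairing \<Omega> p (wgrad \<phi>)"
      unfolding pairing_def[symmetric] using test_functions_in_X(2)[OF \<phi>]
      by (intro pairing_cong_AE Z_measurable p Y_measurable X_D(3) test_functions_in_X(1) \<phi>
          continuous_on_UNIV_lebesgue_on_measurable[OF test_function_C1(3)[OF \<phi>] open_domain])
         (auto elim: eventually_mono)
    then show "(LINT x|M. p x \<bullet> grad \<phi> x) = - (LINT x|M. e x * \<phi> x)"
      using eq[OF test_functions_in_X(1)[OF \<phi>]] by simp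
  qed
  note dd = distr_div_eq[OF div e]
  have "(LINT x|M. distr_div \<Omega> p x * u x) = (LINT x|M. e x * u x)" if "u \<in> X" for u
    using dd e X_D(1)[OF that]
    by (intro integral_cong_AE) (auto simp: sq_integrable_def elim: eventually_mono)
  then have "p \<in> K"
    using p(1) e div eq by (auto simp: K_set_def L2_iff pairing_def)
  with p show False by simp
qed

section \<open>The dual objective and the value of the dual problem\<close>

lemma dual_objective_pairing:
  assumes f: "sq_integrable M f" and p: "p \<in> Z"
  shows "fenchel_dual_objective X Y wgrad (F_fun \<Omega> f) (G_fun \<Omega> \<alpha> \<gamma> \<kappa>) (pairing \<Omega> p) =
    (if p \<in> K then dual_expr \<Omega> \<alpha> \<gamma> \<kappa> f p else - \<infinity>)"
proof (cases "p \<in> K")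
  case True
  then show ?thesis
    unfolding fenchel_dual_objective_def conjugate_F_in_K[OF f True] conjugate_G[OF p]
    by (simp add: dual_expr_def)
next
  case False
  \<comment> \<open>Excludes the difference of two negative infinities, which \<open>ereal\<close>
    arithmetic evaluates to plus infinity.\<close>
  have "0 \<le> enn2ereal (modular \<Omega> (phi_star \<alpha> \<gamma> \<kappa>) p)" by simp
  with False show ?thesis
    unfolding fenchel_dual_objective_def conjugate_F_notin_K[OF f p False] conjugate_G[OF p]
    by (cases "enn2ereal (modular \<Omega> (phi_star \<alpha> \<gamma> \<kappa>) p)") auto
qed

text \<open>Members of \<open>dual_space\<close> are unconstrained off Y, so the representation by p
  holds only on Y. This suffices because A maps X into Y.\<close>

lemma dual_objective_cong:
  assumes "\<And>v. v \<in> Y \<Longrightarrow> l v = l' v"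
  shows "fenchel_dual_objective X Y wgrad F G l = fenchel_dual_objective X Y wgrad F G l'"
proof -
  have "fenchel_conj X F (\<lambda>u. - (l \<circ> wgrad) u) = fenchel_conj X F (\<lambda>u. - (l' \<circ> wgrad) u)"
    unfolding fenchel_conj_def using assms[OF X_D(3)] by (intro SUP_cong) auto
  moreover have "fenchel_conj Y G l = fenchel_conj Y G l'"
    unfolding fenchel_conj_def using assms by (intro SUP_cong) auto
  ultimately show ?thesis by (simp add: fenchel_dual_objective_def)
qed

lemma dual_problem_value:
  assumes f: "sq_integrable M f"
  shows "(SUP l\<in>dual_space Y nrm. fenchel_dual_objective X Y wgrad (F_fun \<Omega> f) (G_fun \<Omega> \<alpha> \<gamma> \<kappa>) l) =
    (SUP p\<in>K. dual_expr \<Omega> \<alpha> \<gamma> \<kappa> f p)"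
proof (rule antisym)
  let ?D = "fenchel_dual_objective X Y wgrad (F_fun \<Omega> f) (G_fun \<Omega> \<alpha> \<gamma> \<kappa>)"
  show "(SUP l\<in>dual_space Y nrm. ?D l) \<le> (SUP p\<in>K. dual_expr \<Omega> \<alpha> \<gamma> \<kappa> f p)"
  proof (rule SUP_least)
    fix l assume "l \<in> dual_space Y nrm"
    then obtain p where p: "p \<in> Z" "\<And>v. v \<in> Y \<Longrightarrow> l v = pairing \<Omega> p v"
      using dual_space_representation by blast
    have "?D l = (if p \<in> K then dual_expr \<Omega> \<alpha> \<gamma> \<kappa> f p else - \<infinity>)"
      using dual_objective_cong[OF p(2)] dual_objective_pairing[OF f p(1)] by simp
    then show "?D l \<le> (SUP p\<in>K. dual_expr \<Omega> \<alpha> \<gamma> \<kappa> f p)"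
      by (auto intro: SUP_upper)
  qed
  show "(SUP p\<in>K. dual_expr \<Omega> \<alpha> \<gamma> \<kappa> f p) \<le> (SUP l\<in>dual_space Y nrm. ?D l)"
  proof (rule SUP_least)
    fix p assume p: "p \<in> K"
    then have pZ: "p \<in> Z" by (simp add: K_set_def)
    have "dual_expr \<Omega> \<alpha> \<gamma> \<kappa> f p = ?D (pairing \<Omega> p)"
      using dual_objective_pairing[OF f pZ] p by simp
    also have "\<dots> \<le> (SUP l\<in>dual_space Y nrm. ?D l)" by (rule SUP_upper[OF pairing_in_dual_space[OF pZ]])
    finally show "dual_expr \<Omega> \<alpha> \<gamma> \<kappa> f p \<le> (SUP l\<in>dual_space Y nrm. ?D l)" .
  qed
qed

end

theorem lemma4p5:
  fixes \<Omega> :: "(real ^ 'n) set" and f \<kappa> :: "real ^ 'n \<Rightarrow> real"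
    and \<alpha> \<gamma> \<kappa>m \<kappa>p :: real
  assumes "bounded \<Omega>" and "lipschitz_domain \<Omega>"
    and "f \<in> L2 \<Omega>"
    and "\<alpha> > 0" and "\<gamma> > 0"
    and "\<kappa> \<in> borel_measurable (lebesgue_on \<Omega>)"
    and "0 < \<kappa>m" and "AE x in lebesgue_on \<Omega>. \<kappa>m \<le> \<kappa> x \<and> \<kappa> x \<le> \<kappa>p"
  defines "X \<equiv> X_space \<Omega> \<alpha> \<gamma> \<kappa>" and "Y \<equiv> Y_space \<Omega> \<alpha> \<gamma> \<kappa>"
    and "F \<equiv> F_fun \<Omega> f" and "G \<equiv> G_fun \<Omega> \<alpha> \<gamma> \<kappa>"
  defines "D \<equiv> fenchel_dual_objective X Y (weak_grad \<Omega>) F G"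
  shows "(\<forall>u\<in>X. energy \<Omega> \<alpha> \<gamma> \<kappa> f u = F u + G (weak_grad \<Omega> u)) \<and>
    (\<forall>p\<in>MO_space \<Omega> (phi_star \<alpha> \<gamma> \<kappa>).
       D (pairing \<Omega> p) = (if p \<in> K_set \<Omega> \<alpha> \<gamma> \<kappa> then dual_expr \<Omega> \<alpha> \<gamma> \<kappa> f p else - \<infinity>)) \<and>
    (SUP l\<in>dual_space Y (luxemburg_norm \<Omega> (phi \<alpha> \<gamma> \<kappa>)). D l)
      = (SUP p\<in>K_set \<Omega> \<alpha> \<gamma> \<kappa>. dual_expr \<Omega> \<alpha> \<gamma> \<kappa> f p)"
proof -
  text \<open>All objects depend on \<open>\<kappa>\<close> only through the modulars, hence only up to null sets.\<close>
  define k where "k x = max \<kappa>m (min (max \<kappa>m \<kappa>p) (\<kappa> x))" for x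
  have k: "AE x in lebesgue_on \<Omega>. k x = \<kappa> x"
    using assms(8) by eventually_elim (auto simp: k_def)
  \<comment> \<open>The upper bound \<open>max \<kappa>m \<kappa>p\<close> lets the clamped k meet
    both bounds everywhere without first deriving \<kappa>m \<le> \<kappa>p.\<close>
  interpret musielak_orlicz \<Omega> \<alpha> \<gamma> \<kappa>m "max \<kappa>m \<kappa>p" k
  proof
    show "k \<in> borel_measurable (lebesgue_on \<Omega>)" unfolding k_def using assms(6) by measurable
  qed (use assms in \<open>auto simp: lipschitz_domain_def k_def\<close>)
  have phi: "modular \<Omega> (phi \<alpha> \<gamma> \<kappa>) = modular \<Omega> (phi \<alpha> \<gamma> k)"
    unfolding modular_def phi_def using k by (intro ext nn_integral_cong_AE) (auto elim!: eventually_mono)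
  have star: "modular \<Omega> (phi_star \<alpha> \<gamma> \<kappa>) = modular \<Omega> (phi_star \<alpha> \<gamma> k)"
    unfolding modular_def phi_star_def phi_def
    using k by (intro ext nn_integral_cong_AE) (auto elim!: eventually_mono)
  have X: "X_space \<Omega> \<alpha> \<gamma> \<kappa> = X_space \<Omega> \<alpha> \<gamma> k" by (simp add: X_space_def phi)
  have Y: "Y_space \<Omega> \<alpha> \<gamma> \<kappa> = Y_space \<Omega> \<alpha> \<gamma> k" by (simp add: MO_space_def phi)
  have Z: "MO_space \<Omega> (phi_star \<alpha> \<gamma> \<kappa>) = MO_space \<Omega> (phi_star \<alpha> \<gamma> k)" by (simp add: MO_space_def star)
  have K: "K_set \<Omega> \<alpha> \<gamma> \<kappa> = K_set \<Omega> \<alpha> \<gamma> k" by (simp add: K_set_def X Z)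
  have G: "G_fun \<Omega> \<alpha> \<gamma> \<kappa> = G_fun \<Omega> \<alpha> \<gamma> k" by (simp add: G_fun_def fun_eq_iff phi)
  have n: "luxemburg_norm \<Omega> (phi \<alpha> \<gamma> \<kappa>) = luxemburg_norm \<Omega> (phi \<alpha> \<gamma> k)"
    by (simp add: luxemburg_norm_def fun_eq_iff phi)
  have e: "dual_expr \<Omega> \<alpha> \<gamma> \<kappa> = dual_expr \<Omega> \<alpha> \<gamma> k" by (simp add: dual_expr_def fun_eq_iff star)
  have f: "sq_integrable (lebesgue_on \<Omega>) f" using assms(3) by (simp add: L2_iff)
  have "\<forall>u\<in>X. energy \<Omega> \<alpha> \<gamma> \<kappa> f u = F u + G (weak_grad \<Omega> u)"
    by (simp add: energy_def F_def G_def F_fun_def G_fun_def)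
  then show ?thesis
    using dual_objective_pairing[OF f] dual_problem_value[OF f]
    unfolding D_def X_def Y_def F_def G_def X Y Z K G n e by blast
qed

end
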